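(* There exists a universal constant $L>1$ with the following properties. (1) If $\ell\subset\mathbb{R}^3$ is a (straight) line, then $\mathrm{Lip}((\ell,d_K),\mathbb{R}^3)\le L$. (2) If $P\subset\mathbb{R}^3$ is a (affine) plane, then $\mathrm{Lip}((P,d_K),\mathbb{R}^4)\le L$.
   Context: The Heisenberg group $\mathbb{H}$ is $\mathbb{R}^3$ with group law $(x,y,z)\cdot(x',y',z')=(x+x',y+y',z+z'+\tfrac12(xy'-x'y))$. The Korányi metric is $d_K(p,q)=\big(((x-x')^2+(y-y')^2)^2+16(z-z'+\tfrac12(xy'-x'y))^2\big)^{1/4}$ for $p=(x,y,z)$, $q=(x',y',z')$. A map $f:(X,d_X)\to(Y,d_Y)$ is $L$-bi-Lipschitz ($L\ge1$) if $L^{-1}d_X(a,b)\le d_Y(f(a),f(b))\le L d_X(a,b)$ for all $a,b\in X$, and $\mathrm{Lip}(X,Y)$ denotes the infimum of all $L$ for which an $L$-bi-Lipschitz map $X\to Y$ exists ($\infty$ if none). Euclidean spaces carry the Euclidean metric. *)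

theory Defs
  imports "HOL-Analysis.Analysis" "HOL-Library.Extended_Real"
begin

text \<open>Points of the Heisenberg group are points of real^3 with coordinates
  x = p$1, y = p$2, z = p$3.\<close>

definition koranyi :: "real^3 \<Rightarrow> real^3 \<Rightarrow> real" where
  "koranyi p q = root 4 ((((p$1 - q$1)^2 + (p$2 - q$2)^2))^2
      + 16 * (p$3 - q$3 + (1/2) * (p$1 * q$2 - q$1 * p$2))^2)"

definition bilipschitz_on ::
  "real \<Rightarrow> 'a set \<Rightarrow> ('a \<Rightarrow> 'a \<Rightarrow> real) \<Rightarrow> ('b \<Rightarrow> 'b \<Rightarrow> real) \<Rightarrow> ('a \<Rightarrow> 'b) \<Rightarrow> bool" where
  "bilipschitz_on L X dX dY f \<longleftrightarrow> L \<ge> 1 \<and>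
     (\<forall>a\<in>X. \<forall>b\<in>X. dX a b / L \<le> dY (f a) (f b) \<and> dY (f a) (f b) \<le> L * dX a b)"

text \<open>Lip((X,dX),(Y,dY)): infimum of all L admitting an L-bi-Lipschitz map X \<rightarrow> Y;
  infimum of the empty set in ereal is \<infinity>.\<close>
definition Lip_const ::
  "'a set \<Rightarrow> ('a \<Rightarrow> 'a \<Rightarrow> real) \<Rightarrow> 'b set \<Rightarrow> ('b \<Rightarrow> 'b \<Rightarrow> real) \<Rightarrow> ereal" where
  "Lip_const X dX Y dY =
     Inf {ereal L | L. \<exists>f. f ` X \<subseteq> Y \<and> bilipschitz_on L X dX dY f}"

end

theory Submission
  imports Defs
begin

text \<open>A self-avoiding walk of unit steps in the lattice \<open>\<int>\<^sup>3\<close> is refined by scaling it by 6 and replacing each edge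
  by a congruent copy of one fixed self-avoiding path with 36 steps that stays in a bipyramid around the
  edge. The bipyramids over all lattice edges have disjoint interiors, so the refined walk is again
  self-avoiding. In the limit, the edges of level \<open>k\<close>, which are \<open>36\<^sup>-\<^sup>k\<close> long in time and \<open>6\<^sup>-\<^sup>k\<close> in space, force
  \<open>|F s - F t|\<close> to be comparable to \<open>\<surd>|s - t|\<close> at small scales.

  On a line the Koranyi metric is comparable to \<open>A |s - t| + B \<surd>|s - t|\<close>: refining the straight walk gives this
  metric in \<open>\<real>\<^sup>3\<close> for \<open>A, B > 0\<close>, and the walk that is invariant under refinement gives it for \<open>A = 0\<close>. A vertical
  plane is the product of \<open>\<real>\<close> with the metric \<open>\<surd>|s - t|\<close> on \<open>\<real>\<close>. Every other plane is isometric to \<open>z = 0\<close>, the cone over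
  the circle with the square root of the arc metric; refining the unit square embeds this circle in \<open>\<real>\<^sup>3\<close>, and
  the cone over its image embeds in \<open>\<real>\<^sup>4\<close>.\<close>

section \<open>Refinement of lattice walks\<close>

definition unit_step :: "int^3 \<Rightarrow> bool" where
  "unit_step u \<longleftrightarrow> \<bar>u$1\<bar> + \<bar>u$2\<bar> + \<bar>u$3\<bar> = 1"

text \<open>A signed coordinate permutation that sends the first basis vector to the unit step \<^term>\<open>u\<close>.\<close>

definition rot :: "int^3 \<Rightarrow> int^3 \<Rightarrow> int^3" where
  "rot u p = (\<chi> i. if u$i \<noteq> 0 then u$i * p$1
     else if i = 1 then (if u$2 \<noteq> 0 then p$2 else p$3) else p$i)"

lemma unit_step_cases:
  assumes "unit_step u"
  obtains s where "s = 1 \<or> s = -1" "u$1 = s" "u$2 = 0" "u$3 = 0"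
    | s where "s = 1 \<or> s = -1" "u$1 = 0" "u$2 = s" "u$3 = 0"
    | s where "s = 1 \<or> s = -1" "u$1 = 0" "u$2 = 0" "u$3 = s"
proof -
  have "(u$2 = 0 \<and> u$3 = 0 \<and> (u$1 = 1 \<or> u$1 = -1)) \<or> (u$1 = 0 \<and> u$3 = 0 \<and> (u$2 = 1 \<or> u$2 = -1))
     \<or> (u$1 = 0 \<and> u$2 = 0 \<and> (u$3 = 1 \<or> u$3 = -1))"
    using assms unfolding unit_step_def by arith
  then show ?thesis using that by blast
qed

lemma unit_step_rot: "unit_step u \<Longrightarrow> unit_step w \<Longrightarrow> unit_step (rot u w)"
  by (erule unit_step_cases) (auto simp: unit_step_def rot_def)

lemma rot_diff: "rot u (p - q) = rot u p - rot u q"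
  by (auto simp: rot_def vec_eq_iff algebra_simps)

lemma rot_zero [simp]: "rot u 0 = 0"
  by (auto simp: rot_def vec_eq_iff)

lemma rot_axis: "unit_step u \<Longrightarrow> rot u (vector [c, 0, 0]) = c *s u"
  by (erule unit_step_cases) (auto simp: rot_def vec_eq_iff forall_3)

lemma rot_inject: "unit_step u \<Longrightarrow> rot u p = rot u q \<longleftrightarrow> p = q"
  by (erule unit_step_cases) (auto simp: rot_def vec_eq_iff forall_3)

text \<open>A spiral in the layer \<open>x = 2\<close>, a detour through the layer \<open>x = 3\<close> and a spiral back to the axis
  in the layer \<open>x = 4\<close>. Only five properties matter: 36 unit steps, no repeated point, interior points
  in the open bipyramid \<open>max \<bar>y\<bar> \<bar>z\<bar> < min x (6 - x)\<close>, and a first and a last step along the axis.\<close>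

definition gen_list :: "(int \<times> int \<times> int) list" where
  "gen_list = [(0,0,0), (1,0,0),
    (2,0,0), (2,1,0), (2,1,1), (2,0,1), (2,-1,1), (2,-1,0), (2,-1,-1), (2,0,-1), (2,1,-1),
    (3,1,-1), (3,1,-2), (3,2,-2), (3,2,-1), (3,2,0), (3,1,0), (3,1,1), (3,2,1), (3,2,2),
    (3,1,2), (3,0,2), (3,-1,2), (3,-2,2), (3,-2,1), (3,-1,1),
    (4,-1,1), (4,0,1), (4,1,1), (4,1,0), (4,1,-1), (4,0,-1), (4,-1,-1), (4,-1,0), (4,0,0),
    (5,0,0), (6,0,0)]"

definition gen :: "nat \<Rightarrow> int^3" where
  "gen n = (case gen_list ! n of (x, y, z) \<Rightarrow> vector [x, y, z])"

lemma length_gen_list: "length gen_list = 37"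
  by (simp add: gen_list_def)

lemma gen_0 [simp]: "gen 0 = 0" and gen_1: "gen 1 = vector [1, 0, 0]"
  and gen_35: "gen 35 = vector [5, 0, 0]" and gen_36: "gen 36 = vector [6, 0, 0]"
  by (simp_all add: gen_def gen_list_def vec_eq_iff forall_3)

lemma gen_inj:
  assumes "k \<le> 36" "l \<le> 36" "gen k = gen l" shows "k = l"
proof -
  have "distinct gen_list" unfolding gen_list_def by simp
  moreover have "gen_list ! k = gen_list ! l"
    using assms(3) by (auto simp: gen_def vec_eq_iff forall_3 split: prod.splits)
  ultimately show ?thesis
    using assms by (simp add: nth_eq_iff_index_eq length_gen_list)
qed

lemma gen_step:
  assumes "k < 36" shows "unit_step (gen (k + 1) - gen k)"
proof -
  have "list_all (\<lambda>k. case (gen_list ! k, gen_list ! (k + 1)) of ((x, y, z), (x', y', z')) \<Rightarrow>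
      \<bar>x' - x\<bar> + \<bar>y' - y\<bar> + \<bar>z' - z\<bar> = 1) [0..<36]"
    unfolding gen_list_def by code_simp
  then show ?thesis
    using assms by (auto simp: list_all_iff unit_step_def gen_def split: prod.splits)
qed

lemma gen_bipyramid:
  assumes "0 < k" "k < 36"
  shows "\<bar>gen k $ 2\<bar> < min (gen k $ 1) (6 - gen k $ 1)" "\<bar>gen k $ 3\<bar> < min (gen k $ 1) (6 - gen k $ 1)"
proof -
  have *: "list_all (\<lambda>k. case gen_list ! k of (x, y, z) \<Rightarrow>
      \<bar>y\<bar> < min x (6 - x) \<and> \<bar>z\<bar> < min x (6 - x)) [1..<36]"
    unfolding gen_list_def by code_simp
  have "k \<in> set [1..<36]" using assms by simp
  from *[unfolded list_all_iff, rule_format, OF this] show "\<bar>gen k $ 2\<bar> < min (gen k $ 1) (6 - gen k $ 1)" "\<bar>gen k $ 3\<bar> < min (gen k $ 1) (6 - gen k $ 1)"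
    by (auto simp: gen_def split: prod.splits)
qed

lemma gen_bounds:
  assumes "k \<le> 36"
  shows "0 \<le> gen k $ 1" "gen k $ 1 \<le> 6" "\<bar>gen k $ 2\<bar> \<le> 2" "\<bar>gen k $ 3\<bar> \<le> 2"
proof -
  consider "k = 0" | "k = 36" | "0 < k" "k < 36" using assms by linarith
  then have "0 \<le> gen k $ 1 \<and> gen k $ 1 \<le> 6 \<and> \<bar>gen k $ 2\<bar> \<le> 2 \<and> \<bar>gen k $ 3\<bar> \<le> 2"
  proof cases
    case 3 then show ?thesis using gen_bipyramid[of k] by auto
  qed (auto simp: gen_36)
  then show "0 \<le> gen k $ 1" "gen k $ 1 \<le> 6" "\<bar>gen k $ 2\<bar> \<le> 2" "\<bar>gen k $ 3\<bar> \<le> 2" by auto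
qed

section \<open>Replacing each edge of a walk by the generator path\<close>

definition refine :: "(int \<Rightarrow> int^3) \<Rightarrow> int \<Rightarrow> int^3" where
  "refine V n = (let j = n div 36 in 6 *s V j + rot (V (j + 1) - V j) (gen (nat (n mod 36))))"

text \<open>The generator ends at 6 times the axis vector, so at \<open>k = 36\<close> the copy on
  edge \<open>j\<close> meets the start of the copy on edge \<open>j + 1\<close>. Admitting
  \<open>k = 36\<close> lets a step from \<open>k\<close> to \<open>k + 1\<close> be computed on one
  edge without a change of \<open>j\<close>.\<close>

lemma refine_eq:
  assumes "unit_step (V (j + 1) - V j)" "k \<le> 36"
  shows "refine V (36 * j + int k) = 6 *s V j + rot (V (j + 1) - V j) (gen k)"
proof (cases "k = 36")
  case True
  have "(36 * j + 36) div 36 = j + 1" "(36 * j + 36) mod 36 = 0" by simp_all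
  then have "refine V (36 * j + int k) = 6 *s V (j + 1)"
    using True by (simp add: refine_def Let_def)
  also have "\<dots> = 6 *s V j + 6 *s (V (j + 1) - V j)"
    by (simp add: vec_eq_iff algebra_simps)
  finally show ?thesis using True assms by (simp add: gen_36 rot_axis)
next
  case False
  then have "(36 * j + int k) div 36 = j" "(36 * j + int k) mod 36 = int k"
    using assms(2) by auto
  then show ?thesis by (simp add: refine_def Let_def)
qed

text \<open>The equation puts \<open>s * x\<close> at distance \<open>\<bar>y\<bar>\<close> from a
  multiple of 6, and the nearest multiple of 6 is at distance \<open>min x (6 - x)\<close>.\<close>

lemma edge_offset_large:
  fixes a b s x y :: int
  assumes "6 * a + s * x = 6 * b + y" "s = 1 \<or> s = -1" "0 < x" "x < 6"
  shows "min x (6 - x) \<le> \<bar>y\<bar>"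
proof -
  define n where "n = b - a"
  have "s * x - y = 6 * n" using assms(1) by (simp add: n_def)
  moreover have "n \<le> -1 \<or> n = 0 \<or> n \<ge> 1" by linarith
  ultimately show ?thesis using assms(2-4) by auto
qed

lemma round_eq:
  fixes a b x y :: int
  assumes "6 * a + x = 6 * b + y" "\<bar>x\<bar> < 3" "\<bar>y\<bar> < 3"
  shows "a = b"
  using assms by linarith

text \<open>Both sides lie strictly inside one and the same gap between consecutive multiples of 6.
  The two edges cover this gap either in the same direction from the same end or in opposite
  directions from opposite ends.\<close>

lemma edge_axis_eq:
  fixes a b s s' x y :: int
  assumes "6 * a + s * x = 6 * b + s' * y" "s = 1 \<or> s = -1" "s' = 1 \<or> s' = -1"
    "0 < x" "x < 6" "0 < y" "y < 6"
  shows "(a = b \<and> s = s') \<or> (a = b + s' \<and> a + s = b)"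
proof -
  define n where "n = b - a"
  have "s * x - s' * y = 6 * n" using assms(1) by (simp add: n_def)
  then have "n = 0 \<and> s = s' \<or> n = s \<and> s' = -s"
    using assms(2-) by auto
  then show ?thesis by (auto simp: n_def)
qed

text \<open>The open bipyramids over distinct lattice edges (scaled by 6) are disjoint: a point determines the
  direction of its edge as the coordinate farthest from the multiples of 6, and then the edge by rounding.\<close>

lemma edge_eq:
  assumes u: "unit_step u" and u': "unit_step u'"
    and g: "\<bar>g$2\<bar> < min (g$1) (6 - g$1)" "\<bar>g$3\<bar> < min (g$1) (6 - g$1)"
    and g': "\<bar>g'$2\<bar> < min (g'$1) (6 - g'$1)" "\<bar>g'$3\<bar> < min (g'$1) (6 - g'$1)"
    and eq: "6 *s v + rot u g = 6 *s v' + rot u' g'"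
  shows "(v = v' \<and> u = u') \<or> (v = v' + u' \<and> v + u = v')"
proof -
  have e: "6 * v$i + rot u g $ i = 6 * v'$i + rot u' g' $ i" for i
    using eq by (simp add: vec_eq_iff)
  have g1: "0 < g$1" "g$1 < 6" "\<bar>g$2\<bar> < 3" "\<bar>g$3\<bar> < 3"
    and g1': "0 < g'$1" "g'$1 < 6" "\<bar>g'$2\<bar> < 3" "\<bar>g'$3\<bar> < 3"
    using g g' by linarith+
  \<comment> \<open>These serve edges of different directions. Along the axis of either edge, the
    other point has only a transverse offset. If m and m' are the two minima, the bipyramid
    conditions give m <= (offset of g') < m' <= (offset of g) < m, which is absurd.\<close>
  have far: "min (g$1) (6 - g$1) \<le> \<bar>y\<bar>" if "6 * a + s * g$1 = 6 * b + y" "s = 1 \<or> s = -1" for a b s y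
    using edge_offset_large[OF that g1(1,2)] .
  have far': "min (g'$1) (6 - g'$1) \<le> \<bar>y\<bar>" if "6 * b + y = 6 * a + s * g'$1" "s = 1 \<or> s = -1" for b y a s
    using edge_offset_large[OF that(1)[symmetric] that(2) g1'(1,2)] .
  note e1 = e[of 1] and e2 = e[of 2] and e3 = e[of 3]
  show ?thesis
    using u
  proof (cases rule: unit_step_cases)
    case (1 s)
    show ?thesis using u'
    proof (cases rule: unit_step_cases)
      case c: (1 s')
      have "v$2 = v'$2" "v$3 = v'$3"
        using round_eq[of "v$2" "g$2" "v'$2" "g'$2"] round_eq[of "v$3" "g$3" "v'$3" "g'$3"] e2 e3 1 c g1 g1'
        by (auto simp: rot_def)
      moreover have "(v$1 = v'$1 \<and> s = s') \<or> (v$1 = v'$1 + s' \<and> v$1 + s = v'$1)"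
        by (rule edge_axis_eq[of _ _ "g$1" _ _ "g'$1"]) (use e1 1 c g1 g1' in \<open>auto simp: rot_def\<close>)
      ultimately show ?thesis using 1 c by (auto simp: vec_eq_iff forall_3)
    next
      case c: (2 s')
      have "min (g$1) (6 - g$1) \<le> \<bar>g'$2\<bar>"
        by (rule far[of "v$1" s "v'$1" "g'$2"]) (use e1 1 c in \<open>auto simp: rot_def\<close>)
      moreover have "min (g'$1) (6 - g'$1) \<le> \<bar>g$2\<bar>"
        by (rule far'[of "v$2" "g$2" "v'$2" s']) (use e2 1 c in \<open>auto simp: rot_def\<close>)
      ultimately show ?thesis using g g' by linarith
    next
      case c: (3 s')
      have "min (g$1) (6 - g$1) \<le> \<bar>g'$3\<bar>"
        by (rule far[of "v$1" s "v'$1" "g'$3"]) (use e1 1 c in \<open>auto simp: rot_def\<close>)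
      moreover have "min (g'$1) (6 - g'$1) \<le> \<bar>g$3\<bar>"
        by (rule far'[of "v$3" "g$3" "v'$3" s']) (use e3 1 c in \<open>auto simp: rot_def\<close>)
      ultimately show ?thesis using g g' by linarith
    qed
  next
    case (2 s)
    show ?thesis using u'
    proof (cases rule: unit_step_cases)
      case c: (1 s')
      have "min (g'$1) (6 - g'$1) \<le> \<bar>g$2\<bar>"
        by (rule far'[of "v$1" "g$2" "v'$1" s']) (use e1 2 c in \<open>auto simp: rot_def\<close>)
      moreover have "min (g$1) (6 - g$1) \<le> \<bar>g'$2\<bar>"
        by (rule far[of "v$2" s "v'$2" "g'$2"]) (use e2 2 c in \<open>auto simp: rot_def\<close>)
      ultimately show ?thesis using g g' by linarith
    next
      case c: (2 s')
      have "v$1 = v'$1" "v$3 = v'$3"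
        using round_eq[of "v$1" "g$2" "v'$1" "g'$2"] round_eq[of "v$3" "g$3" "v'$3" "g'$3"] e1 e3 2 c g1 g1'
        by (auto simp: rot_def)
      moreover have "(v$2 = v'$2 \<and> s = s') \<or> (v$2 = v'$2 + s' \<and> v$2 + s = v'$2)"
        by (rule edge_axis_eq[of _ _ "g$1" _ _ "g'$1"]) (use e2 2 c g1 g1' in \<open>auto simp: rot_def\<close>)
      ultimately show ?thesis using 2 c by (auto simp: vec_eq_iff forall_3)
    next
      case c: (3 s')
      have "min (g$1) (6 - g$1) \<le> \<bar>g'$2\<bar>"
        by (rule far[of "v$2" s "v'$2" "g'$2"]) (use e2 2 c in \<open>auto simp: rot_def\<close>)
      moreover have "min (g'$1) (6 - g'$1) \<le> \<bar>g$3\<bar>"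
        by (rule far'[of "v$3" "g$3" "v'$3" s']) (use e3 2 c in \<open>auto simp: rot_def\<close>)
      ultimately show ?thesis using g g' by linarith
    qed
  next
    case (3 s)
    show ?thesis using u'
    proof (cases rule: unit_step_cases)
      case c: (1 s')
      have "min (g'$1) (6 - g'$1) \<le> \<bar>g$3\<bar>"
        by (rule far'[of "v$1" "g$3" "v'$1" s']) (use e1 3 c in \<open>auto simp: rot_def\<close>)
      moreover have "min (g$1) (6 - g$1) \<le> \<bar>g'$3\<bar>"
        by (rule far[of "v$3" s "v'$3" "g'$3"]) (use e3 3 c in \<open>auto simp: rot_def\<close>)
      ultimately show ?thesis using g g' by linarith
    next
      case c: (2 s')
      have "min (g'$1) (6 - g'$1) \<le> \<bar>g$2\<bar>"
        by (rule far'[of "v$2" "g$2" "v'$2" s']) (use e2 3 c in \<open>auto simp: rot_def\<close>)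
      moreover have "min (g$1) (6 - g$1) \<le> \<bar>g'$3\<bar>"
        by (rule far[of "v$3" s "v'$3" "g'$3"]) (use e3 3 c in \<open>auto simp: rot_def\<close>)
      ultimately show ?thesis using g g' by linarith
    next
      case c: (3 s')
      have "v$1 = v'$1" "v$2 = v'$2"
        using round_eq[of "v$1" "g$3" "v'$1" "g'$3"] round_eq[of "v$2" "g$2" "v'$2" "g'$2"] e1 e2 3 c g1 g1'
        by (auto simp: rot_def)
      moreover have "(v$3 = v'$3 \<and> s = s') \<or> (v$3 = v'$3 + s' \<and> v$3 + s = v'$3)"
        by (rule edge_axis_eq[of _ _ "g$1" _ _ "g'$1"]) (use e3 3 c g1 g1' in \<open>auto simp: rot_def\<close>)
      ultimately show ?thesis using 3 c by (auto simp: vec_eq_iff forall_3)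
    qed
  qed
qed

text \<open>In the coordinate along the edge, the left side lies strictly between consecutive
  multiples of 6.\<close>

lemma vertex_not_edge:
  assumes u: "unit_step u" and g: "0 < g$1" "g$1 < 6"
  shows "6 *s v + rot u g \<noteq> 6 *s w"
proof
  assume eq: "6 *s v + rot u g = 6 *s w"
  have e: "6 * v$i + rot u g $ i = 6 * w$i + 0" for i
    using eq by (simp add: vec_eq_iff)
  have "0 < min (g$1) (6 - g$1)" using g by simp
  moreover have "min (g$1) (6 - g$1) \<le> \<bar>0\<bar>"
    using u
  proof (cases rule: unit_step_cases)
    case (1 s)
    then show ?thesis using edge_offset_large[of "v$1" s "g$1" "w$1" 0] e[of 1] 1 g by (auto simp: rot_def)
  next
    case (2 s)
    then show ?thesis using edge_offset_large[of "v$2" s "g$1" "w$2" 0] e[of 2] 2 g by (auto simp: rot_def)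
  next
    case (3 s)
    then show ?thesis using edge_offset_large[of "v$3" s "g$1" "w$3" 0] e[of 3] 3 g by (auto simp: rot_def)
  qed
  ultimately show False by linarith
qed

text \<open>The period \<open>p = 0\<close> means that the walk is injective.\<close>

definition walk :: "int \<Rightarrow> (int \<Rightarrow> int^3) \<Rightarrow> bool" where
  "walk p V \<longleftrightarrow> (\<forall>j. unit_step (V (j + 1) - V j)) \<and> (\<forall>i j. V i = V j \<longleftrightarrow> p dvd i - j)"

lemma div_mod_36:
  obtains j k where "n = 36 * j + int k" "k < 36"
proof
  show "n = 36 * (n div 36) + int (nat (n mod 36))" "nat (n mod 36) < 36" by auto
qed

lemma unit_step_refine:
  assumes "\<And>j. unit_step (V (j + 1) - V j)"
  shows "unit_step (refine V (n + 1) - refine V n)"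
proof -
  obtain j k where n: "n = 36 * j + int k" "k < 36" by (rule div_mod_36)
  have "refine V (n + 1) = 6 *s V j + rot (V (j + 1) - V j) (gen (k + 1))"
    using refine_eq[of V j "k + 1", OF assms] n by (simp add: ac_simps)
  moreover have "refine V n = 6 *s V j + rot (V (j + 1) - V j) (gen k)"
    using refine_eq[of V j k] assms n by simp
  ultimately show ?thesis
    using assms n gen_step[of k] by (simp add: rot_diff[symmetric] unit_step_rot)
qed

text \<open>Period 1 or 2 is excluded because a closed walk of length 2 uses an edge in both directions.\<close>

lemma walk_refine:
  assumes V: "walk p V" and p: "\<not> p dvd 2"
  shows "walk (36 * p) (refine V)"
  unfolding walk_def
proof (intro conjI allI)
  have st: "unit_step (V (j + 1) - V j)" for j using V by (simp add: walk_def)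
  have inj: "V i = V j \<longleftrightarrow> p dvd i - j" for i j using V by (simp add: walk_def)
  show "unit_step (refine V (j + 1) - refine V j)" for j
    using st by (rule unit_step_refine)
  have pos: "0 < gen k $ 1" "gen k $ 1 < 6" if "0 < k" "k < 36" for k
    using gen_bipyramid[OF that] by linarith+
  fix n n'
  obtain j k where n: "n = 36 * j + int k" "k < 36" by (rule div_mod_36)
  obtain j' k' where n': "n' = 36 * j' + int k'" "k' < 36" by (rule div_mod_36)
  have r: "refine V n = 6 *s V j + rot (V (j + 1) - V j) (gen k)"
    using refine_eq[of V j k] st n by simp
  have r': "refine V n' = 6 *s V j' + rot (V (j' + 1) - V j') (gen k')"
    using refine_eq[of V j' k'] st n' by simp
  show "refine V n = refine V n' \<longleftrightarrow> 36 * p dvd n - n'"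
  proof
    assume d: "36 * p dvd n - n'"
    then have "36 dvd n - n'" by (rule dvd_mult_left)
    then have "n mod 36 = n' mod 36" by (simp add: mod_eq_dvd_iff)
    moreover have "n mod 36 = int k" "n' mod 36 = int k'" using n n' by auto
    ultimately have k: "k = k'" by simp
    then have "n - n' = 36 * (j - j')" using n n' by simp
    then have "p dvd j - j'" using d by (metis dvd_mult_cancel_left zero_neq_numeral)
    then have "V j = V j'" "V (j + 1) = V (j' + 1)" using inj by auto
    then show "refine V n = refine V n'" using r r' k by simp
  next
    assume eq: "refine V n = refine V n'"
    have "k = k' \<and> p dvd j - j'"
    proof (cases "k = 0 \<or> k' = 0")
      case True
      have "k = 0 \<and> k' = 0"
      proof (rule ccontr)
        assume "\<not> ?thesis"
        then consider "k = 0" "0 < k'" | "0 < k" "k' = 0" using True by auto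
        then show False
        proof cases
          case 1
          then show False using vertex_not_edge[OF st, of "gen k'" "V j'" j' "V j"] pos[of k'] n'(2) eq r r' by simp
        next
          case 2
          then show False using vertex_not_edge[OF st, of "gen k" "V j" j "V j'"] pos[of k] n(2) eq r r' by simp
        qed
      qed
      then show ?thesis using eq r r' inj[of j j'] by (simp add: vec_eq_iff)
    next
      case False
      have "(V j = V j' \<and> V (j + 1) - V j = V (j' + 1) - V j') \<or>
          (V j = V j' + (V (j' + 1) - V j') \<and> V j + (V (j + 1) - V j) = V j')"
        using False n n' eq r r' by (intro edge_eq[of _ _ "gen k" "gen k'"] st gen_bipyramid) auto
      moreover have False if "V j = V (j' + 1)" "V (j + 1) = V j'"
      proof -
        have "p dvd j - (j' + 1)" "p dvd (j + 1) - j'" using that inj by auto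
        then have "p dvd ((j + 1) - j') - (j - (j' + 1))" by (rule dvd_diff[rotated])
        with p show False by simp
      qed
      ultimately have *: "V j = V j'" "V (j + 1) - V j = V (j' + 1) - V j'" by auto
      then have "gen k = gen k'" using eq r r' rot_inject[OF st, of j] by simp
      then show ?thesis using gen_inj[of k k'] n n' * inj by simp
    qed
    then have "n - n' = 36 * (j - j')" "p dvd j - j'" using n n' by simp_all
    then show "36 * p dvd n - n'" by (simp only: mult_dvd_mono dvd_refl)
  qed
qed

section \<open>The limit curve\<close>

definition level :: "(int \<Rightarrow> int^3) \<Rightarrow> nat \<Rightarrow> int \<Rightarrow> int^3" where
  "level V k = (refine ^^ k) V"

lemma level_0 [simp]: "level V 0 = V" and level_Suc: "level V (Suc k) = refine (level V k)"
  by (simp_all add: level_def)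

lemma walk_level:
  assumes "walk p V" "\<not> p dvd 2" shows "walk (36 ^ k * p) (level V k)"
proof (induction k)
  case (Suc k)
  have "\<not> 36 ^ k * p dvd 2" using assms(2) by (meson dvd_mult_right)
  with Suc show ?case using walk_refine[of "36 ^ k * p"] by (simp add: level_Suc mult.assoc)
qed (use assms in simp)

lemma unit_step_level:
  assumes "\<And>j. unit_step (V (j + 1) - V j)"
  shows "unit_step (level V k (j + 1) - level V k j)"
proof (induction k arbitrary: j)
  case (Suc k) then show ?case unfolding level_Suc by (rule unit_step_refine)
qed (use assms in simp)

section \<open>Bounding boxes of edges and their nesting under refinement\<close>

definition lower :: "(int \<Rightarrow> int^3) \<Rightarrow> int \<Rightarrow> 3 \<Rightarrow> int" where
  "lower V j i = min (V j $ i) (V (j + 1) $ i)"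

definition upper :: "(int \<Rightarrow> int^3) \<Rightarrow> int \<Rightarrow> 3 \<Rightarrow> int" where
  "upper V j i = max (V j $ i) (V (j + 1) $ i)"

lemma unit_step_component: "unit_step u \<Longrightarrow> \<bar>u $ i\<bar> \<le> 1"
  using exhaust_3[of i] by (auto simp: unit_step_def)

text \<open>The slack 2 is the transverse reach of the generator; along the axis the generator stays
  between 0 and 6.\<close>

lemma rot_bounds:
  assumes "unit_step u" "k \<le> 36"
  shows "min 0 (6 * u $ i) - 2 \<le> rot u (gen k) $ i" "rot u (gen k) $ i \<le> max 0 (6 * u $ i) + 2"
proof -
  have "min 0 (6 * u $ i) - 2 \<le> rot u (gen k) $ i \<and> rot u (gen k) $ i \<le> max 0 (6 * u $ i) + 2"
    using assms(1) gen_bounds[OF assms(2)] exhaust_3[of i]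
    by (elim unit_step_cases disjE) (simp_all add: rot_def abs_le_iff)
  then show "min 0 (6 * u $ i) - 2 \<le> rot u (gen k) $ i" "rot u (gen k) $ i \<le> max 0 (6 * u $ i) + 2"
    by auto
qed

lemma refine_bounds:
  assumes "\<And>j. unit_step (V (j + 1) - V j)" "k \<le> 36"
  shows "6 * lower V j i - 2 \<le> refine V (36 * j + int k) $ i"
    "refine V (36 * j + int k) $ i \<le> 6 * upper V j i + 2"
proof -
  define u where "u = V (j + 1) - V j"
  have *: "refine V (36 * j + int k) $ i = 6 * V j $ i + rot u (gen k) $ i"
    using refine_eq[of V j k, OF assms] by (simp add: u_def)
  have "lower V j i = V j $ i + min 0 (u $ i)" "upper V j i = V j $ i + max 0 (u $ i)"
    by (auto simp: u_def lower_def upper_def)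
  then show "6 * lower V j i - 2 \<le> refine V (36 * j + int k) $ i"
    "refine V (36 * j + int k) $ i \<le> 6 * upper V j i + 2"
    using rot_bounds[OF assms(1) assms(2), of j i, folded u_def] * by linarith+
qed

lemma lower_upper_refine:
  assumes "\<And>j. unit_step (V (j + 1) - V j)"
  shows "6 * lower V (n div 36) i - 2 \<le> lower (refine V) n i"
    "upper (refine V) n i \<le> 6 * upper V (n div 36) i + 2"
proof -
  obtain j k where n: "n = 36 * j + int k" "k < 36" by (rule div_mod_36)
  \<comment> \<open>Both ends of the refined edge are written over the same parent edge
    \<open>j\<close>, which for \<open>k = 35\<close> relies on the index 36 being allowed.\<close>
  then have j: "n div 36 = j" and n1: "n + 1 = 36 * j + int (k + 1)" by simp_all
  have "6 * lower V j i - 2 \<le> refine V n $ i" "refine V n $ i \<le> 6 * upper V j i + 2"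
    using refine_bounds[of V k j i, OF assms] n(2) unfolding n(1) by simp_all
  moreover have "6 * lower V j i - 2 \<le> refine V (n + 1) $ i" "refine V (n + 1) $ i \<le> 6 * upper V j i + 2"
    using refine_bounds[of V "k + 1" j i, OF assms] n(2) unfolding n1 by simp_all
  ultimately show "6 * lower V (n div 36) i - 2 \<le> lower (refine V) n i"
    "upper (refine V) n i \<le> 6 * upper V (n div 36) i + 2"
    unfolding j lower_def[of "refine V"] upper_def[of "refine V"] by simp_all
qed

definition index :: "nat \<Rightarrow> real \<Rightarrow> int" where
  "index k t = \<lfloor>36 ^ k * t\<rfloor>"

lemma index_Suc_div: "index (Suc k) t div 36 = index k t"
proof -
  have "\<lfloor>36 ^ Suc k * t / of_int 36\<rfloor> = \<lfloor>36 ^ Suc k * t\<rfloor> div 36"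
    by (rule floor_divide_real_eq_div) simp
  then show ?thesis by (simp add: index_def)
qed

text \<open>Refined points deviate by at most 2 from the parent edge (scaled by 6), and \<open>6 * (2/5) = 2 + 2/5\<close>, so
  boxes around the edges enlarged by \<open>2/5\<close> are nested. Since \<open>2/5 < 1/2\<close>, disjoint edges keep disjoint
  boxes.\<close>

definition cell_lower :: "(int \<Rightarrow> int^3) \<Rightarrow> real \<Rightarrow> 3 \<Rightarrow> nat \<Rightarrow> real" where
  "cell_lower V t i k = (of_int (lower (level V k) (index k t) i) - 2/5) / 6 ^ k"

definition cell_upper :: "(int \<Rightarrow> int^3) \<Rightarrow> real \<Rightarrow> 3 \<Rightarrow> nat \<Rightarrow> real" where
  "cell_upper V t i k = (of_int (upper (level V k) (index k t) i) + 2/5) / 6 ^ k"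

text \<open>The supremum of the lower ends of nested intervals lies in all of them, so the limit
  point is available without a convergence argument.\<close>

definition curve :: "(int \<Rightarrow> int^3) \<Rightarrow> real \<Rightarrow> real^3" where
  "curve V t = (\<chi> i. SUP k. cell_lower V t i k)"

lemma cell_nested:
  assumes V: "\<And>j. unit_step (V (j + 1) - V j)"
  shows "cell_lower V t i k \<le> cell_lower V t i (Suc k)" "cell_upper V t i (Suc k) \<le> cell_upper V t i k"
proof -
  note st = unit_step_level[of V, OF V]
  have "6 * lower (level V k) (index k t) i - 2 \<le> lower (level V (Suc k)) (index (Suc k) t) i"
    "upper (level V (Suc k)) (index (Suc k) t) i \<le> 6 * upper (level V k) (index k t) i + 2"
    using lower_upper_refine[of "level V k" "index (Suc k) t" i] st
    by (simp_all add: level_Suc index_Suc_div)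
  then have "real_of_int (6 * lower (level V k) (index k t) i - 2) \<le> of_int (lower (level V (Suc k)) (index (Suc k) t) i)"
    "real_of_int (upper (level V (Suc k)) (index (Suc k) t) i) \<le> of_int (6 * upper (level V k) (index k t) i + 2)"
    by (simp_all only: of_int_le_iff)
  moreover have "cell_lower V t i k = (of_int (6 * lower (level V k) (index k t) i - 2) - 2/5) / 6 ^ Suc k"
    "cell_upper V t i k = (of_int (6 * upper (level V k) (index k t) i + 2) + 2/5) / 6 ^ Suc k"
    by (simp_all add: cell_lower_def cell_upper_def diff_divide_distrib add_divide_distrib)
  ultimately show "cell_lower V t i k \<le> cell_lower V t i (Suc k)" "cell_upper V t i (Suc k) \<le> cell_upper V t i k"
    by (simp_all only: cell_lower_def[of V t i "Suc k"] cell_upper_def[of V t i "Suc k"]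
      divide_le_cancel) auto
qed

lemma curve_in_cell:
  assumes V: "\<And>j. unit_step (V (j + 1) - V j)"
  shows "cell_lower V t i k \<le> curve V t $ i" "curve V t $ i \<le> cell_upper V t i k"
proof -
  have "incseq (cell_lower V t i)" "decseq (cell_upper V t i)"
    using cell_nested[of V, OF V] by (auto intro: incseq_SucI decseq_SucI)
  moreover have "cell_lower V t i k \<le> cell_upper V t i k" for k
    by (auto simp: cell_lower_def cell_upper_def lower_def upper_def intro!: divide_right_mono)
  ultimately have le: "cell_lower V t i l \<le> cell_upper V t i k" for k l
    using incseqD[of "cell_lower V t i" l "max k l"] decseqD[of "cell_upper V t i" k "max k l"]
    by (meson max.cobounded1 max.cobounded2 order_trans)
  then have "bdd_above (range (cell_lower V t i))" by (intro bdd_aboveI[of _ "cell_upper V t i 0"]) auto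
  then show "cell_lower V t i k \<le> curve V t $ i" by (auto simp: curve_def intro: cSUP_upper)
  show "curve V t $ i \<le> cell_upper V t i k" using le by (auto simp: curve_def intro: cSUP_least)
qed

text \<open>The box around an edge extends from the starting vertex by at most the edge length 1
  plus the margin \<open>2/5\<close>, which gives \<open>7/5\<close>.\<close>

lemma curve_near:
  assumes V: "\<And>j. unit_step (V (j + 1) - V j)"
  shows "\<bar>curve V t $ i - of_int (level V k (index k t) $ i) / 6 ^ k\<bar> \<le> 7 / 5 / 6 ^ k"
proof -
  define n where "n = index k t"
  have "\<bar>level V k (n + 1) $ i - level V k n $ i\<bar> \<le> 1"
    using unit_step_component[OF unit_step_level[of V, OF V]] by simp
  then have "level V k n $ i - 1 \<le> lower (level V k) n i" "upper (level V k) n i \<le> level V k n $ i + 1"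
    by (auto simp: lower_def upper_def)
  then have "real_of_int (level V k n $ i - 1) \<le> of_int (lower (level V k) n i)"
    "real_of_int (upper (level V k) n i) \<le> of_int (level V k n $ i + 1)"
    by (simp_all only: of_int_le_iff)
  then have "(of_int (level V k n $ i) - 7 / 5) / 6 ^ k \<le> cell_lower V t i k"
    "cell_upper V t i k \<le> (of_int (level V k n $ i) + 7 / 5) / 6 ^ k"
    by (auto simp: cell_lower_def cell_upper_def n_def intro!: divide_right_mono)
  then show ?thesis
    using curve_in_cell[of V, OF V, of t i k] by (simp add: n_def add_divide_distrib diff_divide_distrib)
qed

lemma walk_component_diff:
  assumes V: "\<And>j. unit_step (V (j + 1) - V j)"
  shows "\<bar>V m $ i - V n $ i\<bar> \<le> \<bar>m - n\<bar>"
proof -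
  have *: "\<bar>V (n + int d) $ i - V n $ i\<bar> \<le> int d" for n d
  proof (induction d)
    case (Suc d)
    then show ?case using unit_step_component[OF V, of "n + int d" i] by (simp add: ac_simps)
  qed simp
  show ?thesis
    using *[of n "nat (m - n)"] *[of m "nat (n - m)"] by (cases "n \<le> m") auto
qed

text \<open>Two disjoint lattice edges are separated by a unit gap in some coordinate: otherwise their
  bounding boxes share a lattice point, and an edge contains no lattice points but its ends.\<close>

lemma edges_gap:
  assumes V: "\<And>j. unit_step (V (j + 1) - V j)"
    and ne: "V m \<noteq> V n" "V m \<noteq> V (n + 1)" "V (m + 1) \<noteq> V n" "V (m + 1) \<noteq> V (n + 1)"
  obtains i where "upper V m i < lower V n i \<or> upper V n i < lower V m i"
proof -
  have "\<exists>i. upper V m i < lower V n i \<or> upper V n i < lower V m i"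
  proof (rule ccontr)
    assume "\<not> ?thesis"
    then have *: "lower V n i \<le> upper V m i" "lower V m i \<le> upper V n i" for i by (auto simp: not_less)
    \<comment> \<open>The lowest corner of the intersection of the two boxes; it is a lattice point
      and so must be an end of both edges.\<close>
    define q where "q = (\<chi> i. max (lower V m i) (lower V n i))"
    have vert: "q = V j \<or> q = V (j + 1)" if "\<And>i. lower V j i \<le> q $ i" "\<And>i. q $ i \<le> upper V j i" for j
    proof -
      define u where "u = V (j + 1) - V j"
      have "unit_step u" using V by (simp add: u_def)
      moreover have "min 0 (u $ i) \<le> (q - V j) $ i" "(q - V j) $ i \<le> max 0 (u $ i)" for i
        using that[of i] by (auto simp: u_def lower_def upper_def)
      moreover note this[of 1] this[of 2] this[of 3]
      ultimately have "q - V j = 0 \<or> q - V j = u"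
        by (elim unit_step_cases) (auto simp: vec_eq_iff forall_3)
      then show ?thesis by (auto simp: u_def)
    qed
    have "lower V j i \<le> upper V j i" for j i by (auto simp: lower_def upper_def)
    then have "q = V m \<or> q = V (m + 1)" "q = V n \<or> q = V (n + 1)"
      using * by (intro vert; simp add: q_def)+
    then show False using ne by auto
  qed
  then show ?thesis using that by blast
qed

text \<open>The hypotheses say that the edges of level \<open>k\<close> at the two times have no
  common vertex: their indices do not differ by -1, 0 or 1 modulo the period of that level. Of the
  unit gap between the edges, the two margins leave \<open>1 - 2 * (2/5) = 1/5\<close>.\<close>

lemma curve_gap:
  assumes V: "walk p V" "\<not> p dvd 2"
    and ne: "\<not> 36 ^ k * p dvd index k s - index k t" "\<not> 36 ^ k * p dvd index k s - index k t - 1"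
      "\<not> 36 ^ k * p dvd index k s - index k t + 1"
  obtains i where "1 / 5 / 6 ^ k \<le> \<bar>curve V s $ i - curve V t $ i\<bar>"
proof -
  have st: "\<And>j. unit_step (V (j + 1) - V j)" using V by (simp add: walk_def)
  define m n W where "m = index k s" and "n = index k t" and "W = level V k"
  have W: "W i = W j \<longleftrightarrow> 36 ^ k * p dvd i - j" for i j
    using walk_level[OF V, of k] by (simp add: W_def walk_def)
  have sW: "unit_step (W (j + 1) - W j)" for j unfolding W_def by (rule unit_step_level[of V, OF st])
  obtain i where i: "upper W m i < lower W n i \<or> upper W n i < lower W m i"
  proof (rule edges_gap[of W m n, OF sW])
    show "W m \<noteq> W n" "W m \<noteq> W (n + 1)" "W (m + 1) \<noteq> W n" "W (m + 1) \<noteq> W (n + 1)"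
      using ne by (auto simp: W m_def n_def algebra_simps)
  qed blast
  have gap: "1 / 5 / 6 ^ k \<le> curve V t' $ i - curve V s' $ i"
    if "upper W (index k s') i < lower W (index k t') i" for s' t'
  proof -
    have "real_of_int (upper W (index k s') i + 1) \<le> of_int (lower W (index k t') i)"
      using that by (simp only: of_int_le_iff)
    then have "1 / 5 / 6 ^ k \<le> cell_lower V t' i k - cell_upper V s' i k"
      unfolding cell_lower_def cell_upper_def W_def diff_divide_distrib[symmetric]
      by (intro divide_right_mono) auto
    then show ?thesis
      using curve_in_cell[of V, OF st, of t' i k] curve_in_cell[of V, OF st, of s' i k] by linarith
  qed
  have "1 / 5 / 6 ^ k \<le> \<bar>curve V s $ i - curve V t $ i\<bar>"
    using i gap[of s t] gap[of t s] by (auto simp: m_def n_def)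
  then show ?thesis by (rule that)
qed

section \<open>Square-root snowflakes\<close>

lemma index_diff_le: "\<bar>real_of_int (index k s - index k t)\<bar> \<le> 36 ^ k * \<bar>s - t\<bar> + 1"
proof -
  have "\<bar>36 ^ k * s - 36 ^ k * t\<bar> = 36 ^ k * \<bar>s - t\<bar>"
    by (simp add: abs_mult flip: right_diff_distrib)
  then show ?thesis unfolding index_def by linarith
qed

lemma index_diff_ge:
  assumes "2 \<le> 36 ^ k * \<bar>s - t\<bar>" shows "2 \<le> \<bar>index k s - index k t\<bar>"
proof -
  have "\<bar>36 ^ k * s - 36 ^ k * t\<bar> = 36 ^ k * \<bar>s - t\<bar>"
    by (simp add: abs_mult flip: right_diff_distrib)
  then show ?thesis using assms unfolding index_def by linarith
qed

text \<open>In each coordinate the walk moves by at most the index difference, where the floors cost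
  1, and the two curve points add \<open>2 * (7/5)\<close>; the total excess is below 4. The factor
  3 comes from the sum over the coordinates.\<close>

lemma curve_dist_le:
  assumes V: "\<And>j. unit_step (V (j + 1) - V j)"
  shows "norm (curve V s - curve V t) \<le> 3 * (36 ^ k * \<bar>s - t\<bar> + 4) / 6 ^ k"
proof -
  have "\<bar>curve V s $ i - curve V t $ i\<bar> \<le> (36 ^ k * \<bar>s - t\<bar> + 4) / 6 ^ k" for i
  proof -
    let ?a = "level V k (index k s) $ i" and ?b = "level V k (index k t) $ i"
    have "\<bar>?a - ?b\<bar> \<le> \<bar>index k s - index k t\<bar>"
      by (rule walk_component_diff[of "level V k", OF unit_step_level[of V, OF V]])
    then have "\<bar>real_of_int ?a - real_of_int ?b\<bar> \<le> 36 ^ k * \<bar>s - t\<bar> + 1"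
      using index_diff_le[of k s t] by linarith
    then have "\<bar>real_of_int ?a - real_of_int ?b\<bar> / 6 ^ k \<le> (36 ^ k * \<bar>s - t\<bar> + 1) / 6 ^ k"
      by (intro divide_right_mono) auto
    then have "\<bar>real_of_int ?a / 6 ^ k - real_of_int ?b / 6 ^ k\<bar> \<le> (36 ^ k * \<bar>s - t\<bar> + 1) / 6 ^ k"
      by (simp flip: diff_divide_distrib)
    moreover have "(36 ^ k * \<bar>s - t\<bar> + 1) / 6 ^ k + (7 / 5 / 6 ^ k + 7 / 5 / 6 ^ k) \<le> (36 ^ k * \<bar>s - t\<bar> + 4) / 6 ^ k"
      unfolding add_divide_distrib[symmetric] by (intro divide_right_mono) auto
    ultimately show ?thesis
      using curve_near[of V s i k, OF V] curve_near[of V t i k, OF V] by linarith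
  qed
  then have "(\<Sum>i\<in>UNIV. \<bar>(curve V s - curve V t) $ i\<bar>) \<le> (\<Sum>i\<in>(UNIV::3 set). (36 ^ k * \<bar>s - t\<bar> + 4) / 6 ^ k)"
    by (intro sum_mono) simp
  then show ?thesis using norm_le_l1_cart[of "curve V s - curve V t"] by simp
qed

text \<open>Take the least admissible \<open>k\<close>. One level earlier the product is below 2, or
  \<open>k = 1\<close> and \<open>u \<le> 2\<close> is used, so the product at level
  \<open>k\<close> is at most \<open>36 * 2\<close>. Periodic walks need
  \<open>1 \<le> k\<close>.\<close>

lemma scale_exists:
  fixes u :: real
  assumes "0 < u" "u \<le> 2"
  obtains k where "1 \<le> k" "2 \<le> 36 ^ k * u" "36 ^ k * u \<le> 72"
proof -
  define P where "P n \<longleftrightarrow> 2 \<le> 36 ^ Suc n * u" for n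
  obtain n where "2 / u < 36 ^ n" using real_arch_pow[of 36 "2 / u"] by auto
  then have "2 < 36 ^ n * u" using assms by (simp add: field_simps)
  then have ex: "P n" unfolding P_def power_Suc mult.assoc by linarith
  define m where "m = (LEAST n. P n)"
  have m: "P m" unfolding m_def using ex by (rule LeastI)
  have "36 ^ Suc m * u \<le> 72"
  proof (cases m)
    case (Suc l)
    then have "\<not> P l" using not_less_Least[of l P] by (simp add: m_def)
    then show ?thesis by (simp add: P_def Suc)
  qed (use assms in simp)
  then show ?thesis using that[of "Suc m"] m by (simp add: P_def)
qed

lemma power_36: "(36::real) ^ k = (6 ^ k)\<^sup>2"
  by (simp add: power2_eq_square flip: power_mult_distrib)

text \<open>A rescaled time difference of at least 2 forces an index difference of at least 2, so
  the two edges are not neighbours and \<open>curve_gap\<close> applies. For a closed walk the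
  hypothesis \<open>wrap\<close> also prevents the times from coming close again around the
  loop.\<close>

lemma curve_dist_ge:
  assumes V: "walk p V" and p: "p = 0 \<or> 4 \<le> p" and k: "2 \<le> 36 ^ k * \<bar>s - t\<bar>"
    and wrap: "p = 0 \<or> 1 \<le> k \<and> 36 ^ k * \<bar>s - t\<bar> \<le> 72"
  shows "1 / 5 / 6 ^ k \<le> norm (curve V s - curve V t)"
proof -
  have p2: "\<not> p dvd 2" using p zdvd_imp_le[of p 2] by auto
  define d where "d = index k s - index k t"
  have d2: "2 \<le> \<bar>d\<bar>" using index_diff_ge[OF k] by (simp add: d_def)
  have far: "\<not> 36 ^ k * p dvd d + e" if "\<bar>e\<bar> \<le> 1" for e
  proof
    assume dvd: "36 ^ k * p dvd d + e"
    show False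
    proof (cases "p = 0")
      case True
      then show False using dvd d2 that by simp
    next
      case False
      \<comment> \<open>The shifted index difference is at most 73 + 1 in absolute value, while the
        period of level \<open>k\<close> is at least \<open>36 * 4 = 144\<close>.\<close>
      then have "36 \<le> (36::int) ^ k" "real_of_int \<bar>d\<bar> \<le> 73"
        using wrap self_le_power[of "36::int" k] index_diff_le[of k s t] by (auto simp: d_def)
      moreover from this have "36 * 4 \<le> 36 ^ k * p" using p False by (intro mult_mono) auto
      moreover have "36 ^ k * p \<le> \<bar>d + e\<bar>"
        using dvd d2 that by (intro zdvd_imp_le) auto
      ultimately show False using that by linarith
    qed
  qed
  obtain i where "1 / 5 / 6 ^ k \<le> \<bar>curve V s $ i - curve V t $ i\<bar>"
    using curve_gap[OF V p2, of k s t] far[of 0] far[of "-1"] far[of 1] by (auto simp: d_def)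
  then show ?thesis using component_le_norm_cart[of "curve V s - curve V t" i] by simp
qed

lemma curve_snowflake:
  assumes V: "walk p V" and p: "p = 0 \<or> 4 \<le> p" and u: "\<bar>s - t\<bar> \<le> 2"
  shows "sqrt \<bar>s - t\<bar> / 45 \<le> norm (curve V s - curve V t)"
    "norm (curve V s - curve V t) \<le> 228 * sqrt \<bar>s - t\<bar>"
proof -
  have "sqrt \<bar>s - t\<bar> / 45 \<le> norm (curve V s - curve V t) \<and> norm (curve V s - curve V t) \<le> 228 * sqrt \<bar>s - t\<bar>"
  proof (cases "s = t")
    case False
    then obtain k where k: "1 \<le> k" "2 \<le> 36 ^ k * \<bar>s - t\<bar>" "36 ^ k * \<bar>s - t\<bar> \<le> 72"
      using scale_exists[of "\<bar>s - t\<bar>"] u by auto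
    \<comment> \<open>As the product lies between 2 and 72, the root of the time difference lies
      between \<open>1 / 6 ^ k\<close> and \<open>9 / 6 ^ k\<close>. Hence the constants
      \<open>45 = 5 * 9\<close> and \<open>228 = 3 * (72 + 4)\<close>.\<close>
    have "\<bar>s - t\<bar> \<le> 72 / 36 ^ k" using k(3) by (simp add: pos_le_divide_eq mult.commute)
    also have "\<dots> \<le> (9 / 6 ^ k)\<^sup>2" unfolding power_36 power_divide by (intro divide_right_mono) auto
    finally have lo: "sqrt \<bar>s - t\<bar> \<le> 9 / 6 ^ k" by (intro real_le_lsqrt) auto
    have "(1 / 6 ^ k)\<^sup>2 \<le> (2 / 36 ^ k :: real)" unfolding power_36 power_divide by (intro divide_right_mono) auto
    also have "\<dots> \<le> \<bar>s - t\<bar>" using k(2) by (simp add: pos_divide_le_eq mult.commute)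
    finally have hi: "1 / 6 ^ k \<le> sqrt \<bar>s - t\<bar>" by (rule real_le_rsqrt)
    have "1 / 5 / 6 ^ k \<le> norm (curve V s - curve V t)"
      using curve_dist_ge[OF V p k(2)] k by blast
    moreover have "norm (curve V s - curve V t) \<le> 3 * (36 ^ k * \<bar>s - t\<bar> + 4) / 6 ^ k"
      using V by (intro curve_dist_le) (simp add: walk_def)
    moreover have "3 * (36 ^ k * \<bar>s - t\<bar> + 4) / 6 ^ k \<le> 3 * (72 + 4) / 6 ^ k"
      by (intro divide_right_mono mult_left_mono add_right_mono k(3)) auto
    ultimately show ?thesis using lo hi by auto
  qed simp
  then show "sqrt \<bar>s - t\<bar> / 45 \<le> norm (curve V s - curve V t)"
    "norm (curve V s - curve V t) \<le> 228 * sqrt \<bar>s - t\<bar>" by auto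
qed

section \<open>The straight walk: linear at large scales, square root at small scales\<close>

definition line_walk :: "int \<Rightarrow> int^3" where
  "line_walk j = vector [j, 0, 0]"

lemma walk_line: "walk 0 line_walk"
  by (auto simp: walk_def line_walk_def unit_step_def vec_eq_iff forall_3)

lemma line_curve_bounds:
  "(\<bar>s - t\<bar> + sqrt \<bar>s - t\<bar>) / 228 \<le> norm (curve line_walk s - curve line_walk t)"
  "norm (curve line_walk s - curve line_walk t) \<le> 228 * (\<bar>s - t\<bar> + sqrt \<bar>s - t\<bar>)"
proof -
  define u n where "u = \<bar>s - t\<bar>" and "n = norm (curve line_walk s - curve line_walk t)"
  have st: "\<And>j. unit_step (line_walk (j + 1) - line_walk j)" using walk_line by (simp add: walk_def)
  have "u \<ge> 0" by (simp add: u_def)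
  have "(u + sqrt u) / 228 \<le> n \<and> n \<le> 228 * (u + sqrt u)"
  proof (cases "u \<le> 2")
    case True
    have "u = sqrt u * sqrt u" using \<open>u \<ge> 0\<close> by simp
    also have "\<dots> \<le> 2 * sqrt u" using True \<open>u \<ge> 0\<close> real_sqrt_le_mono[of u 4] by (intro mult_right_mono) auto
    finally have "u \<le> 2 * sqrt u" .
    moreover have "sqrt u / 45 \<le> n" "n \<le> 228 * sqrt u"
      using curve_snowflake[OF walk_line, of s t] True by (auto simp: u_def n_def)
    moreover have "0 \<le> sqrt u" using \<open>u \<ge> 0\<close> by simp
    ultimately show ?thesis using \<open>u \<ge> 0\<close> by auto
  next
    case False
    then have "sqrt u \<le> u" using \<open>u \<ge> 0\<close> by (intro real_le_lsqrt) (auto simp: power2_eq_square)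
    have "n \<le> 3 * (u + 4)"
      using curve_dist_le[of line_walk s t 0, OF st] by (simp add: u_def n_def)
    \<comment> \<open>The bound \<open>u - 4\<close> below is useless for \<open>u\<close> up to 4
      and weak just above; the gap at level 0 covers this range.\<close>
    moreover have "1 / 5 \<le> n"
      using curve_dist_ge[OF walk_line, of 0 s t] False by (simp add: u_def n_def)
    moreover have "u - 4 \<le> n"
    proof -
      have "\<bar>curve line_walk x $ 1 - of_int \<lfloor>x\<rfloor>\<bar> \<le> 7 / 5" for x
        using curve_near[of line_walk x 1 0, OF st] by (simp add: line_walk_def index_def)
      from this[of s] this[of t] have "u - 4 \<le> \<bar>curve line_walk s $ 1 - curve line_walk t $ 1\<bar>"
        unfolding u_def by linarith
      then show ?thesis using component_le_norm_cart[of "curve line_walk s - curve line_walk t" 1]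
        by (simp add: n_def)
    qed
    moreover have "0 \<le> sqrt u" using \<open>u \<ge> 0\<close> by simp
    ultimately show ?thesis using False \<open>sqrt u \<le> u\<close> by argo
  qed
  then show "(\<bar>s - t\<bar> + sqrt \<bar>s - t\<bar>) / 228 \<le> norm (curve line_walk s - curve line_walk t)"
    "norm (curve line_walk s - curve line_walk t) \<le> 228 * (\<bar>s - t\<bar> + sqrt \<bar>s - t\<bar>)"
    by (auto simp: u_def n_def)
qed

section \<open>The walk that is invariant under refinement, and its self-similar curve\<close>

lemma refine_cong:
  assumes "\<And>i. \<bar>i\<bar> \<le> M \<Longrightarrow> V i = V' i" "\<bar>n\<bar> \<le> 36 * M"
  shows "refine V n = refine V' n"
proof -
  have b: "- M \<le> n div 36" "n div 36 \<le> M" using assms(2) by linarith+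
  then have eq: "V (n div 36) = V' (n div 36)" by (intro assms) simp
  show ?thesis
  proof (cases "n div 36 = M")
    \<comment> \<open>At \<open>n = 36 * M\<close> the definition refers to
      \<open>V (M + 1)\<close>, about which nothing is assumed, but only through a direction applied
      to \<open>gen 0 = 0\<close>.\<close>
    case True
    then have "n mod 36 = 0"
      using assms(2) mult_div_mod_eq[of 36 n] pos_mod_sign[of 36 n] by linarith
    then show ?thesis using eq by (simp add: refine_def Let_def)
  next
    case False
    then have "V (n div 36 + 1) = V' (n div 36 + 1)" using b by (intro assms) simp
    then show ?thesis using eq by (simp add: refine_def Let_def)
  qed
qed

lemma level_line_Suc:
  assumes "\<bar>n\<bar> \<le> 36 ^ k" shows "level line_walk (Suc k) n = level line_walk k n"
  using assms
proof (induction k arbitrary: n)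
  case 0
  \<comment> \<open>Index 1 is the first generator step. Index -1 is position 35 on the edge from -1
    to 0, where the generator has reached 5 on the axis, and
    \<open>6 * (-1) + 5 = -1\<close>.\<close>
  then have "n = -1 \<or> n = 0 \<or> n = 1" by auto
  then show ?case
    by (auto simp: level_Suc refine_def Let_def line_walk_def rot_def gen_1[simplified] gen_35 vec_eq_iff forall_3)
next
  case (Suc k)
  have "refine (level line_walk (Suc k)) n = refine (level line_walk k) n"
    using Suc by (intro refine_cong[of "36 ^ k"]) auto
  then show ?case by (simp only: level_Suc)
qed

lemma level_line_stable:
  assumes "\<bar>n\<bar> \<le> 36 ^ k" "k \<le> l" shows "level line_walk l n = level line_walk k n"
  using assms(2)
proof (induction l rule: dec_induct)
  case (step l)
  have "(36::int) ^ k \<le> 36 ^ l" using step.hyps by (intro power_increasing) auto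
  then have "\<bar>n\<bar> \<le> 36 ^ l" using assms(1) by linarith
  then show ?case using step.IH level_line_Suc by simp
qed simp

text \<open>The first and last steps of the generator lie on the axis, so refining the line walk repeatedly
  stabilises every point. The limit is a fixed point of refinement, whence its curve is self-similar.\<close>

definition fixed_walk :: "int \<Rightarrow> int^3" where
  "fixed_walk n = level line_walk (nat \<bar>n\<bar>) n"

lemma le_power_36: "\<bar>n::int\<bar> \<le> 36 ^ nat \<bar>n\<bar>"
proof -
  have "nat \<bar>n\<bar> \<le> 36 ^ nat \<bar>n\<bar>" by (intro less_imp_le power_gt_expt) simp
  then have "int (nat \<bar>n\<bar>) \<le> int (36 ^ nat \<bar>n\<bar>)" by (simp only: of_nat_le_iff)
  then show ?thesis by simp
qed

lemma fixed_walk_eq: "\<bar>n\<bar> \<le> 36 ^ k \<Longrightarrow> fixed_walk n = level line_walk k n"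
  unfolding fixed_walk_def
  using level_line_stable[of n k "max k (nat \<bar>n\<bar>)"]
    level_line_stable[of n "nat \<bar>n\<bar>" "max k (nat \<bar>n\<bar>)", OF le_power_36] by simp

lemma walk_fixed: "walk 0 fixed_walk"
proof -
  have w: "walk 0 (level line_walk k)" for k using walk_level[OF walk_line, of k] by simp
  have "unit_step (fixed_walk (j + 1) - fixed_walk j)" for j
  proof -
    define k where "k = nat (\<bar>j\<bar> + 1)"
    have "\<bar>j\<bar> + 1 \<le> 36 ^ k" using le_power_36[of "\<bar>j\<bar> + 1"] by (simp add: k_def)
    then show ?thesis using w[of k] by (simp add: walk_def fixed_walk_eq[of _ k])
  qed
  moreover have "fixed_walk i = fixed_walk j \<longleftrightarrow> 0 dvd i - j" for i j
  proof -
    define k where "k = nat (\<bar>i\<bar> + \<bar>j\<bar>)"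
    have "\<bar>i\<bar> + \<bar>j\<bar> \<le> 36 ^ k" using le_power_36[of "\<bar>i\<bar> + \<bar>j\<bar>"] by (simp add: k_def)
    then show ?thesis using w[of k] by (simp add: walk_def fixed_walk_eq[of _ k])
  qed
  ultimately show ?thesis by (simp add: walk_def)
qed

lemma refine_fixed_walk: "refine fixed_walk = fixed_walk"
proof
  fix n :: int
  define k where "k = nat \<bar>n\<bar>"
  have n: "\<bar>n\<bar> \<le> 36 ^ k" using le_power_36 by (simp add: k_def)
  then have "refine fixed_walk n = refine (level line_walk k) n"
    by (intro refine_cong[of "36 ^ k"] fixed_walk_eq) auto
  also have "\<dots> = fixed_walk n" using n by (simp add: fixed_walk_eq[of n "Suc k"] level_Suc)
  finally show "refine fixed_walk n = fixed_walk n" .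
qed

lemma level_fixed_walk: "level fixed_walk k = fixed_walk"
  by (induction k) (simp_all add: level_Suc refine_fixed_walk)

text \<open>Time \<open>36 * t\<close> at level \<open>k\<close> and time \<open>t\<close> at level
  \<open>k + 1\<close> have the same index, and all levels are the same walk. So one lattice vertex
  approximates both curve points up to the factor 6, with an error that tends to 0.\<close>

lemma curve_fixed_scale: "curve fixed_walk (36 * t) = 6 *\<^sub>R curve fixed_walk t"
proof -
  have st: "\<And>j. unit_step (fixed_walk (j + 1) - fixed_walk j)" using walk_fixed by (simp add: walk_def)
  have "curve fixed_walk (36 * t) $ i = 6 * curve fixed_walk t $ i" for i
  proof -
    define x where "x = curve fixed_walk (36 * t) $ i - 6 * curve fixed_walk t $ i"
    have "\<bar>x\<bar> \<le> (14 / 5) / 6 ^ k" for k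
    proof -
      define e :: real where "e = 7 / 5 / 6 ^ k"
      define w where "w = real_of_int (fixed_walk (index (Suc k) t) $ i) / 6 ^ k"
      have "index k (36 * t) = index (Suc k) t" by (simp add: index_def ac_simps)
      then have "\<bar>curve fixed_walk (36 * t) $ i - w\<bar> \<le> e"
        using curve_near[of fixed_walk "36 * t" i k, OF st] by (simp add: level_fixed_walk w_def e_def)
      moreover have "\<bar>curve fixed_walk t $ i - w / 6\<bar> \<le> e / 6"
        using curve_near[of fixed_walk t i "Suc k", OF st] by (simp add: level_fixed_walk w_def e_def)
      ultimately have "\<bar>x\<bar> \<le> 2 * e" unfolding x_def by linarith
      then show ?thesis by (simp add: e_def)
    qed
    moreover have "(\<lambda>k. (14 / 5) / 6 ^ k :: real) \<longlonglongrightarrow> 0" by (rule LIMSEQ_divide_realpow_zero) simp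
    ultimately have "\<bar>x\<bar> \<le> 0" by (intro LIMSEQ_le_const[of _ 0]) auto
    then show ?thesis by (simp add: x_def)
  qed
  then show ?thesis by (simp add: vec_eq_iff)
qed

lemma curve_fixed_scale_power: "curve fixed_walk (36 ^ k * t) = 6 ^ k *\<^sub>R curve fixed_walk t"
  by (induction k) (simp_all add: curve_fixed_scale mult.assoc)

text \<open>Self-similarity brings every pair of times into the range
  \<open>\<bar>s - t\<bar> \<le> 2\<close> of \<open>curve_snowflake\<close>, and both sides of the
  estimate scale by \<open>6 ^ k\<close>.\<close>

lemma fixed_curve_snowflake:
  "sqrt \<bar>s - t\<bar> / 45 \<le> norm (curve fixed_walk s - curve fixed_walk t)"
  "norm (curve fixed_walk s - curve fixed_walk t) \<le> 228 * sqrt \<bar>s - t\<bar>"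
proof -
  obtain k where k: "\<bar>s - t\<bar> / 2 < 36 ^ k" using real_arch_pow[of 36 "\<bar>s - t\<bar> / 2"] by auto
  define s' t' where "s' = s / 36 ^ k" and "t' = t / 36 ^ k"
  have "s = 36 ^ k * s'" "t = 36 ^ k * t'" by (simp_all add: s'_def t'_def)
  have eq: "\<bar>s - t\<bar> = 36 ^ k * \<bar>s' - t'\<bar>"
    by (simp add: s'_def t'_def abs_divide flip: diff_divide_distrib)
  have "sqrt \<bar>s - t\<bar> = 6 ^ k * sqrt \<bar>s' - t'\<bar>" unfolding eq power_36 by (simp add: real_sqrt_mult)
  moreover have "norm (curve fixed_walk s - curve fixed_walk t) = 6 ^ k * norm (curve fixed_walk s' - curve fixed_walk t')"
    unfolding \<open>s = _\<close> \<open>t = _\<close> curve_fixed_scale_power by (simp flip: scaleR_diff_right)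
  moreover have "\<bar>s' - t'\<bar> \<le> 2" using k eq by (simp add: field_simps)
  then have "sqrt \<bar>s' - t'\<bar> / 45 \<le> norm (curve fixed_walk s' - curve fixed_walk t')"
    "norm (curve fixed_walk s' - curve fixed_walk t') \<le> 228 * sqrt \<bar>s' - t'\<bar>"
    using curve_snowflake[OF walk_fixed, of s' t'] by auto
  ultimately show "sqrt \<bar>s - t\<bar> / 45 \<le> norm (curve fixed_walk s - curve fixed_walk t)"
    "norm (curve fixed_walk s - curve fixed_walk t) \<le> 228 * sqrt \<bar>s - t\<bar>"
    by (simp_all add: field_simps)
qed

section \<open>The closed curve obtained from the unit square\<close>

definition square_walk :: "int \<Rightarrow> int^3" where
  "square_walk j = (if j mod 4 = 0 then vector [0, 0, 0] else if j mod 4 = 1 then vector [1, 0, 0]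
     else if j mod 4 = 2 then vector [1, 1, 0] else vector [0, 1, 0])"

lemma walk_square: "walk 4 square_walk"
  unfolding walk_def
proof (intro conjI allI)
  fix i j :: int
  have r: "n mod 4 = 0 \<or> n mod 4 = 1 \<or> n mod 4 = 2 \<or> n mod 4 = 3" for n :: int by presburger
  have "(j + 1) mod 4 = (j mod 4 + 1) mod 4" by (simp add: mod_simps)
  then show "unit_step (square_walk (j + 1) - square_walk j)"
    using r[of j] by (elim disjE) (simp_all add: square_walk_def unit_step_def)
  have "square_walk i = square_walk j \<longleftrightarrow> i mod 4 = j mod 4"
    using r[of i] r[of j] by (elim disjE) (simp_all add: square_walk_def vec_eq_iff forall_3)
  then show "square_walk i = square_walk j \<longleftrightarrow> 4 dvd i - j" by (simp add: mod_eq_dvd_iff)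
qed

lemma curve_periodic:
  assumes "walk p V" "\<not> p dvd 2" shows "curve V (t + of_int (p * n)) = curve V t"
proof -
  have "index k (t + of_int (p * n)) = index k t + 36 ^ k * p * n" for k
  proof -
    have "36 ^ k * (t + of_int (p * n)) = 36 ^ k * t + of_int (36 ^ k * p * n)" by (simp add: algebra_simps)
    then show ?thesis by (simp only: index_def floor_add_int)
  qed
  moreover have "lower (level V k) (j + 36 ^ k * p * n) i = lower (level V k) j i" for k j i
  proof -
    have *: "level V k (m + 36 ^ k * p * n) = level V k m" for m
      using walk_level[OF assms, of k] by (simp add: walk_def)
    have "level V k (j + 36 ^ k * p * n + 1) = level V k (j + 1)"
      using *[of "j + 1"] by (simp only: ac_simps)
    then show ?thesis by (simp only: lower_def *)
  qed
  ultimately show ?thesis by (simp add: curve_def cell_lower_def[abs_def])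
qed

text \<open>Each coordinate is within \<open>7/5\<close> of 0 or 1. In the cone over this curve, the
  bound limits how far a change of radius can move a point.\<close>

lemma square_curve_bounded: "norm (curve square_walk t) \<le> 9"
proof -
  have "\<bar>curve square_walk t $ i\<bar> \<le> 3" for i
  proof -
    have "0 \<le> square_walk j $ i \<and> square_walk j $ i \<le> 1" for j
      using exhaust_3[of i] by (auto simp: square_walk_def)
    then have "real_of_int 0 \<le> of_int (square_walk (index 0 t) $ i)" "real_of_int (square_walk (index 0 t) $ i) \<le> of_int 1"
      by (simp_all only: of_int_le_iff)
    moreover have "\<bar>curve square_walk t $ i - of_int (square_walk (index 0 t) $ i)\<bar> \<le> 7 / 5"
      using curve_near[of square_walk t i 0] walk_square by (simp add: walk_def)
    ultimately show ?thesis by linarith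
  qed
  then have "(\<Sum>i\<in>UNIV. \<bar>curve square_walk t $ i\<bar>) \<le> (\<Sum>i\<in>(UNIV::3 set). 3)"
    by (intro sum_mono)
  then show ?thesis using norm_le_l1_cart[of "curve square_walk t"] by simp
qed

section \<open>Lines and planes in the Heisenberg group\<close>

text \<open>The larger of \<open>a\<close> and \<open>b\<close> is at least half their sum. The
  range allowed for \<open>x\<close> leaves room for the mixed term that appears on transverse
  planes.\<close>

lemma root4_sum_bounds:
  fixes a b :: real
  assumes "0 \<le> a" "0 \<le> b" "a ^ 4 + b ^ 4 \<le> x" "x \<le> (a + b) ^ 4"
  shows "(a + b) / 2 \<le> root 4 x" "root 4 x \<le> a + b"
proof -
  have "((a + b) / 2) ^ 4 \<le> (max a b) ^ 4" using assms by (intro power_mono) auto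
  also have "\<dots> \<le> a ^ 4 + b ^ 4" using assms by (cases "a \<le> b") auto
  also have "\<dots> \<le> x" by fact
  finally have "root 4 (((a + b) / 2) ^ 4) \<le> root 4 x" by simp
  then show "(a + b) / 2 \<le> root 4 x" using assms by (simp add: real_root_power_cancel del: real_root_le_iff)
  have "root 4 x \<le> root 4 ((a + b) ^ 4)" using assms by simp
  then show "root 4 x \<le> a + b" using assms by (simp add: real_root_power_cancel del: real_root_le_iff)
qed

lemma pow4_sum_le:
  fixes a b :: real
  assumes "0 \<le> a" "0 \<le> b" shows "a ^ 4 + b ^ 4 \<le> (a + b) ^ 4"
proof -
  have "a\<^sup>2 + b\<^sup>2 \<le> (a + b)\<^sup>2" using assms by (simp add: power2_sum)
  then have "(a\<^sup>2 + b\<^sup>2)\<^sup>2 \<le> ((a + b)\<^sup>2)\<^sup>2" by (intro power_mono) auto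
  moreover have "a ^ 4 + b ^ 4 \<le> (a\<^sup>2 + b\<^sup>2)\<^sup>2" by (simp add: power2_sum)
  ultimately show ?thesis by simp
qed

text \<open>\<open>E\<close> is an explicit expression comparable to the metric and need not be a
  metric itself. The factor 2 is the loss in \<open>root4_sum_bounds\<close>.\<close>

lemma Lip_const_le:
  fixes f :: "'a \<Rightarrow> 'b::metric_space"
  assumes "1 \<le> K"
    and "\<And>x y. x \<in> X \<Longrightarrow> y \<in> X \<Longrightarrow> E x y / 2 \<le> d x y \<and> d x y \<le> E x y"
    and "\<And>x y. x \<in> X \<Longrightarrow> y \<in> X \<Longrightarrow> E x y / K \<le> dist (f x) (f y) \<and> dist (f x) (f y) \<le> K * E x y"
  shows "Lip_const X d (UNIV :: 'b set) dist \<le> ereal (2 * K)"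
proof -
  have "d x y / (2 * K) \<le> dist (f x) (f y) \<and> dist (f x) (f y) \<le> 2 * K * d x y" if "x \<in> X" "y \<in> X" for x y
  proof
    have "0 \<le> E x y" using assms(2)[OF that] by linarith
    then have "d x y / (2 * K) \<le> E x y / (1 * K)" using assms(1) assms(2)[OF that] by (intro frac_le) auto
    then show "d x y / (2 * K) \<le> dist (f x) (f y)" using assms(3)[OF that] by simp
    have "K * E x y \<le> K * (2 * d x y)" using assms(1) assms(2)[OF that] by (intro mult_left_mono) auto
    then show "dist (f x) (f y) \<le> 2 * K * d x y" using assms(3)[OF that] by simp
  qed
  then have "bilipschitz_on (2 * K) X d dist f" using assms(1) by (simp add: bilipschitz_on_def)
  then show ?thesis unfolding Lip_const_def by (intro Inf_lower CollectI exI conjI refl) auto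
qed

section \<open>Lines\<close>

lemma line_metric_embedding:
  fixes A B :: real
  assumes "0 \<le> A" "0 \<le> B"
  shows "\<exists>h :: real \<Rightarrow> real^3. \<forall>s t. (A * \<bar>s - t\<bar> + B * sqrt \<bar>s - t\<bar>) / 228 \<le> dist (h s) (h t)
     \<and> dist (h s) (h t) \<le> 228 * (A * \<bar>s - t\<bar> + B * sqrt \<bar>s - t\<bar>)"
proof -
  consider "B = 0" | "A = 0" | "0 < A" "0 < B" using assms by linarith
  then show ?thesis
  proof cases
    case 1
    have "dist ((A * s) *\<^sub>R axis 1 1) ((A * t) *\<^sub>R (axis 1 1 :: real^3)) = A * \<bar>s - t\<bar>" for s t
      using assms by (simp add: dist_norm norm_axis_1 abs_mult flip: scaleR_diff_left right_diff_distrib)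
    then show ?thesis using 1 assms by (intro exI[of _ "\<lambda>s. (A * s) *\<^sub>R axis 1 1"]) simp
  next
    case 2
    have d: "dist (B *\<^sub>R curve fixed_walk s) (B *\<^sub>R curve fixed_walk t) = B * norm (curve fixed_walk s - curve fixed_walk t)" for s t
      using assms by (simp add: dist_norm flip: scaleR_diff_right)
    have "B * (sqrt \<bar>s - t\<bar> / 45) \<le> B * norm (curve fixed_walk s - curve fixed_walk t)"
      "B * norm (curve fixed_walk s - curve fixed_walk t) \<le> B * (228 * sqrt \<bar>s - t\<bar>)" for s t
      by (intro mult_left_mono fixed_curve_snowflake assms)+
    note b = this
    have "B * sqrt \<bar>s - t\<bar> / 228 \<le> dist (B *\<^sub>R curve fixed_walk s) (B *\<^sub>R curve fixed_walk t)"
      "dist (B *\<^sub>R curve fixed_walk s) (B *\<^sub>R curve fixed_walk t) \<le> 228 * (B * sqrt \<bar>s - t\<bar>)" for s t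
      unfolding d using b[of s t] mult_nonneg_nonneg[OF assms(2), of "sqrt \<bar>s - t\<bar>"] by simp_all
    then show ?thesis
      using 2 by (intro exI[of _ "\<lambda>s. B *\<^sub>R curve fixed_walk s"]) simp
  next
    case 3
    \<comment> \<open>Scaling time by \<open>k\<close> and space by \<open>c\<close> reduces to
      \<open>A = B = 1\<close>, because \<open>c * k = A\<close> and \<open>c * sqrt k = B\<close>.
      This keeps the constant independent of \<open>A\<close> and \<open>B\<close>.\<close>
    define c where "c = B\<^sup>2 / A"
    define k where "k = A\<^sup>2 / B\<^sup>2"
    have ck: "0 < c" "0 < k" using 3 by (auto simp: c_def k_def)
    have scale: "c * (\<bar>k * s - k * t\<bar> + sqrt \<bar>k * s - k * t\<bar>) = A * \<bar>s - t\<bar> + B * sqrt \<bar>s - t\<bar>" for s t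
    proof -
      have "\<bar>k * s - k * t\<bar> = k * \<bar>s - t\<bar>" using ck by (simp add: abs_mult flip: right_diff_distrib)
      moreover have "sqrt (k * \<bar>s - t\<bar>) = A / B * sqrt \<bar>s - t\<bar>"
        using 3 by (simp add: k_def real_sqrt_mult real_sqrt_divide)
      moreover have "c * k = A" "c * (A / B) = B" using 3 by (simp_all add: c_def k_def power2_eq_square)
      ultimately show ?thesis by (simp only: distrib_left mult.assoc[symmetric])
    qed
    define h where "h t = c *\<^sub>R curve line_walk (k * t)" for t
    have "dist (h s) (h t) = c * norm (curve line_walk (k * s) - curve line_walk (k * t))" for s t
      using ck by (simp add: h_def dist_norm flip: scaleR_diff_right)
    moreover have "c * ((\<bar>k * s - k * t\<bar> + sqrt \<bar>k * s - k * t\<bar>) / 228) \<le> c * norm (curve line_walk (k * s) - curve line_walk (k * t))"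
      "c * norm (curve line_walk (k * s) - curve line_walk (k * t)) \<le> c * (228 * (\<bar>k * s - k * t\<bar> + sqrt \<bar>k * s - k * t\<bar>))" for s t
      using ck line_curve_bounds[of "k * s" "k * t"] by (intro mult_left_mono; simp)+
    ultimately have "(A * \<bar>s - t\<bar> + B * sqrt \<bar>s - t\<bar>) / 228 \<le> dist (h s) (h t)"
      "dist (h s) (h t) \<le> 228 * (A * \<bar>s - t\<bar> + B * sqrt \<bar>s - t\<bar>)" for s t
      unfolding scale[of s t, symmetric] by (simp_all add: mult.left_commute)
    then show ?thesis by blast
  qed
qed

lemma Lip_line:
  fixes l :: "(real^3) set"
  assumes "affine l" "aff_dim l = 1"
  shows "Lip_const l koranyi (UNIV :: (real^3) set) dist \<le> ereal 456"
proof -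
  have hull: "affine hull l = l" using assms(1) by (simp add: affine_hull_eq)
  obtain B where B: "affine hull B = affine hull l" "\<not> affine_dependent B" "of_nat (card B) = aff_dim l + 1"
    using aff_dim_basis_exists by blast
  from B(3) have "card B = 2" using assms(2) by simp
  then obtain p q where "B = {p, q}" "p \<noteq> q" by (auto simp: card_2_iff)
  have l: "l = range (\<lambda>u. p + u *\<^sub>R (q - p))"
    using B(1) \<open>B = {p, q}\<close> affine_hull_2_alt[of p q] unfolding hull by metis
  define v where "v = q - p"
  have "v \<bullet> v \<noteq> 0" using \<open>p \<noteq> q\<close> by (simp add: v_def)
  define a where "a = sqrt ((v$1)\<^sup>2 + (v$2)\<^sup>2)"
  \<comment> \<open>The terms in \<open>s * t\<close> cancel in the group law, so the vertical part
    of the difference of two points of the line is exactly \<open>\<tau> * (s - t)\<close>. The 2 in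
    \<open>E\<close> is the fourth root of 16.\<close>
  define \<tau> where "\<tau> = v$3 + (p$2 * v$1 - p$1 * v$2) / 2"
  define E where "E s t = a * \<bar>s - t\<bar> + 2 * sqrt \<bar>\<tau>\<bar> * sqrt \<bar>s - t\<bar>" for s t
  obtain h :: "real \<Rightarrow> real^3" where h: "\<And>s t. E s t / 228 \<le> dist (h s) (h t) \<and> dist (h s) (h t) \<le> 228 * E s t"
    using line_metric_embedding[of a "2 * sqrt \<bar>\<tau>\<bar>"] by (auto simp: E_def a_def)
  have E: "E s t / 2 \<le> koranyi (p + s *\<^sub>R v) (p + t *\<^sub>R v) \<and> koranyi (p + s *\<^sub>R v) (p + t *\<^sub>R v) \<le> E s t" for s t
  proof -
    define x y where "x = a * \<bar>s - t\<bar>" and "y = 2 * sqrt \<bar>\<tau>\<bar> * sqrt \<bar>s - t\<bar>"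
    have "x\<^sup>2 = ((v$1)\<^sup>2 + (v$2)\<^sup>2) * (s - t)\<^sup>2" by (simp add: x_def a_def power_mult_distrib)
    moreover have "x ^ 4 = (x\<^sup>2)\<^sup>2" by simp
    ultimately have x4: "x ^ 4 = (((v$1)\<^sup>2 + (v$2)\<^sup>2) * (s - t)\<^sup>2)\<^sup>2" by (simp only:)
    have "y\<^sup>2 = 4 * (\<bar>\<tau>\<bar> * \<bar>s - t\<bar>)" by (simp add: y_def power_mult_distrib)
    then have "(y\<^sup>2)\<^sup>2 = 16 * (\<tau> * (s - t))\<^sup>2" by (simp add: power_mult_distrib)
    then have y4: "y ^ 4 = 16 * (\<tau> * (s - t))\<^sup>2" by (simp flip: power_mult)
    have "koranyi (p + s *\<^sub>R v) (p + t *\<^sub>R v) = root 4 (x ^ 4 + y ^ 4)"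
    proof -
      have "(p + s *\<^sub>R v)$i - (p + t *\<^sub>R v)$i = v$i * (s - t)" for i by (simp add: algebra_simps)
      moreover have "(p + s *\<^sub>R v)$1 * (p + t *\<^sub>R v)$2 - (p + t *\<^sub>R v)$1 * (p + s *\<^sub>R v)$2
          = (p$2 * v$1 - p$1 * v$2) * (s - t)" by (simp add: algebra_simps)
      moreover have "v$3 * (s - t) + 1 / 2 * ((p$2 * v$1 - p$1 * v$2) * (s - t)) = \<tau> * (s - t)"
        by (simp add: \<tau>_def distrib_right)
      ultimately show ?thesis
        unfolding koranyi_def x4 y4 by (simp only: power_mult_distrib distrib_right)
    qed
    moreover have "0 \<le> x" "0 \<le> y" by (simp_all add: x_def y_def a_def)
    ultimately show ?thesis
      using root4_sum_bounds[of x y, OF _ _ order_refl pow4_sum_le] by (simp add: E_def x_def y_def)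
  qed
  \<comment> \<open>Orthogonal projection onto the direction recovers the parameter of a point of
    the line.\<close>
  define c where "c x = ((x - p) \<bullet> v) / (v \<bullet> v)" for x
  have c: "c (p + t *\<^sub>R v) = t" for t using \<open>v \<bullet> v \<noteq> 0\<close> by (simp add: c_def)
  have "Lip_const l koranyi (UNIV :: (real^3) set) dist \<le> ereal (2 * 228)"
  proof (rule Lip_const_le[where E = "\<lambda>x y. E (c x) (c y)" and f = "\<lambda>x. h (c x)"])
    fix x y assume "x \<in> l" "y \<in> l"
    then obtain s t where "x = p + s *\<^sub>R v" "y = p + t *\<^sub>R v" by (auto simp: l v_def)
    then show "E (c x) (c y) / 2 \<le> koranyi x y \<and> koranyi x y \<le> E (c x) (c y)" using E c by simp
    show "E (c x) (c y) / 228 \<le> dist (h (c x)) (h (c y)) \<and> dist (h (c x)) (h (c y)) \<le> 228 * E (c x) (c y)"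
      by (rule h)
  qed simp
  then show ?thesis by simp
qed

section \<open>Products in four dimensions and vertical planes\<close>

definition join :: "real \<Rightarrow> real^3 \<Rightarrow> real^4" where
  "join a v = (\<chi> i. if i = 1 then a else if i = 2 then v$1 else if i = 3 then v$2 else v$3)"

lemma dist_join: "dist (join a v) (join b w) = sqrt ((a - b)\<^sup>2 + (dist v w)\<^sup>2)"
  by (simp add: dist_vec_def L2_set_def sum_4 sum_3 join_def dist_real_def add.assoc sum_nonneg)

lemma dist_join_bounds:
  "\<bar>a - b\<bar> \<le> dist (join a v) (join b w)" "dist v w \<le> dist (join a v) (join b w)"
  "dist (join a v) (join b w) \<le> \<bar>a - b\<bar> + dist v w"
  using sqrt_sum_squares_le_sum_abs[of "a - b" "dist v w"]
  by (auto simp: dist_join intro: real_le_rsqrt)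

lemma Lip_vertical_plane:
  fixes P :: "(real^3) set"
  assumes n: "n\<^sup>2 + m\<^sup>2 = (1::real)" and P: "\<And>x. x \<in> P \<Longrightarrow> n * x$1 + m * x$2 = c"
  shows "Lip_const P koranyi (UNIV :: (real^4) set) dist \<le> ereal 456"
proof -
  \<comment> \<open>\<open>s\<close> is the horizontal coordinate along the plane. On the plane the
    symplectic term is \<open>c * (s y - s x)\<close>, and the shear in \<open>w\<close> absorbs it,
    so the vertical part of the difference becomes \<open>w x - w y\<close>.\<close>
  define s w where "s x = n * x$2 - m * x$1" and "w x = x$3 - c * s x / 2" for x :: "real^3"
  define E where "E x y = \<bar>s x - s y\<bar> + 2 * sqrt \<bar>w x - w y\<bar>" for x y
  define f where "f x = join (s x) (curve fixed_walk (w x))" for x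
  have "Lip_const P koranyi (UNIV :: (real^4) set) dist \<le> ereal (2 * 228)"
  proof (rule Lip_const_le[where E = E and f = f])
    fix x y assume xy: "x \<in> P" "y \<in> P"
    have c: "z$1 = c * n - s z * m" "z$2 = c * m + s z * n" if "z \<in> P" for z
      using n P[OF that] unfolding s_def by algebra+
    define a b where "a = \<bar>s x - s y\<bar>" and "b = 2 * sqrt \<bar>w x - w y\<bar>"
    have "(x$1 - y$1)\<^sup>2 + (x$2 - y$2)\<^sup>2 = (s x - s y)\<^sup>2"
      unfolding c[OF xy(1)] c[OF xy(2)] using n by algebra
    moreover have "x$3 - y$3 + (1/2) * (x$1 * y$2 - y$1 * x$2) = w x - w y"
    proof -
      have "x$1 * y$2 - y$1 * x$2 = c * (s y - s x)"
        unfolding c[OF xy(1)] c[OF xy(2)] using n by algebra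
      then show ?thesis by (simp add: w_def field_simps)
    qed
    moreover have "a ^ 4 = ((s x - s y)\<^sup>2)\<^sup>2"
      by (simp add: a_def flip: power_mult)
    moreover have "b ^ 4 = 16 * (w x - w y)\<^sup>2"
    proof -
      have "b\<^sup>2 = 4 * \<bar>w x - w y\<bar>" by (simp add: b_def power_mult_distrib)
      then have "(b\<^sup>2)\<^sup>2 = 16 * (w x - w y)\<^sup>2" by (simp add: power_mult_distrib)
      then show ?thesis by (simp flip: power_mult)
    qed
    ultimately have "koranyi x y = root 4 (a ^ 4 + b ^ 4)" by (simp add: koranyi_def)
    moreover have "0 \<le> a" "0 \<le> b" by (simp_all add: a_def b_def)
    ultimately show "E x y / 2 \<le> koranyi x y \<and> koranyi x y \<le> E x y"
      using root4_sum_bounds[of a b, OF _ _ order_refl pow4_sum_le] by (simp add: E_def a_def b_def)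
    show "E x y / 228 \<le> dist (f x) (f y) \<and> dist (f x) (f y) \<le> 228 * E x y"
      using dist_join_bounds[where a = "s x" and b = "s y" and v = "curve fixed_walk (w x)" and w = "curve fixed_walk (w y)"]
        fixed_curve_snowflake[of "w x" "w y"]
      unfolding E_def f_def by (simp add: dist_norm)
  qed simp
  then show ?thesis by simp
qed

section \<open>The circle with its snowflaked metric, its cone, and transverse planes\<close>

lemma half_le_sin:
  assumes "0 \<le> x" "x \<le> pi / 2" shows "x / 2 \<le> sin x"
proof -
  \<comment> \<open>With half the angle,
    \<open>sin x = 2 * sin y * cos y \<ge> 2 * y * (cos y)\<^sup>2\<close> by
    \<open>y \<le> tan y\<close>, and \<open>1/2 \<le> (cos y)\<^sup>2\<close> up to
    \<open>pi / 4\<close>.\<close>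
  define y where "y = x / 2"
  have y: "0 \<le> y" "y \<le> pi / 4" using assms by (auto simp: y_def)
  have "cos (pi / 4) \<le> cos y" using y by (intro cos_monotone_0_pi_le) auto
  then have "(cos (pi / 4))\<^sup>2 \<le> (cos y)\<^sup>2" by (intro power_mono) (auto simp: cos_45)
  then have c: "1 / 2 \<le> (cos y)\<^sup>2" by (simp add: cos_45 power_divide)
  have y2: "y < pi / 2" using y pi_gt_zero by linarith
  have "0 < cos y" by (intro cos_gt_zero_pi) (use y y2 in linarith)+
  have "y \<le> tan y" using abs_tan_ge[of y] tan_pos_pi2_le[OF y(1) y2] y(1) y2 by linarith
  then have "y * cos y \<le> sin y" using \<open>0 < cos y\<close> by (simp add: tan_def field_simps)
  then have "2 * (y * cos y) * cos y \<le> 2 * sin y * cos y" using \<open>0 < cos y\<close> by simp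
  moreover have "2 * y * (1 / 2) \<le> 2 * y * (cos y)\<^sup>2" using y c by (intro mult_left_mono) auto
  ultimately show ?thesis using sin_double[of y] by (simp add: y_def power2_eq_square)
qed

text \<open>The factor turns a full angle \<open>2 * pi\<close> into the period 4 of the
  square.\<close>

definition circle_curve :: "real \<Rightarrow> real^3" where
  "circle_curve \<theta> = curve square_walk (2 * \<theta> / pi)"

text \<open>The sine is half the chord between the two angles and thus comparable to the shorter
  arc. Measured in curve time that arc is at most 2, the range in which
  \<open>curve_snowflake\<close> holds for the closed walk.\<close>

lemma circle_curve_bounds:
  "sqrt \<bar>sin ((\<theta> - \<phi>) / 2)\<bar> \<le> 456 * dist (circle_curve \<theta>) (circle_curve \<phi>)"
  "dist (circle_curve \<theta>) (circle_curve \<phi>) \<le> 456 * sqrt \<bar>sin ((\<theta> - \<phi>) / 2)\<bar>"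
proof -
  \<comment> \<open>Both sides have period \<open>2 * pi\<close> in the angle difference, so it can
    be replaced by its representative \<delta> of absolute value at most \<open>pi\<close>.\<close>
  define n where "n = round ((\<theta> - \<phi>) / (2 * pi))"
  define \<delta> where "\<delta> = \<theta> - \<phi> - 2 * pi * of_int n"
  have "\<bar>of_int n - (\<theta> - \<phi>) / (2 * pi)\<bar> \<le> 1 / 2" unfolding n_def by (rule of_int_round_abs_le)
  then have "2 * pi * \<bar>of_int n - (\<theta> - \<phi>) / (2 * pi)\<bar> \<le> 2 * pi * (1 / 2)" by (intro mult_left_mono) auto
  moreover have "2 * pi * \<bar>of_int n - (\<theta> - \<phi>) / (2 * pi)\<bar> = \<bar>2 * pi * (of_int n - (\<theta> - \<phi>) / (2 * pi))\<bar>"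
    by (simp add: abs_mult)
  moreover have "2 * pi * (of_int n - (\<theta> - \<phi>) / (2 * pi)) = - \<delta>" by (simp add: \<delta>_def field_simps)
  ultimately have \<delta>: "\<bar>\<delta>\<bar> \<le> pi" by simp
  have *: "(\<theta> - \<phi>) / 2 = \<delta> / 2 + of_int n * pi" by (simp add: \<delta>_def field_simps)
  have "sin (of_int n * pi) = 0" using sin_zero_iff_int2 by blast
  then have "\<bar>sin ((\<theta> - \<phi>) / 2)\<bar> = \<bar>sin (\<delta> / 2)\<bar>"
    unfolding * by (simp add: sin_add abs_mult sin_zero_abs_cos_one)
  also have "\<dots> = sin (\<bar>\<delta>\<bar> / 2)"
  proof -
    have "0 \<le> sin (\<bar>\<delta>\<bar> / 2)" using \<delta> by (intro sin_ge_zero) auto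
    then show ?thesis by (cases "0 \<le> \<delta>") auto
  qed
  finally have \<sigma>: "\<bar>sin ((\<theta> - \<phi>) / 2)\<bar> = sin (\<bar>\<delta>\<bar> / 2)" .
  define t u where "t = 2 * \<phi> / pi" and "u = 2 * \<bar>\<delta>\<bar> / pi"
  have "2 * \<theta> / pi = t + 2 * \<delta> / pi + of_int (4 * n)" by (simp add: t_def \<delta>_def field_simps)
  then have "circle_curve \<theta> = curve square_walk (t + 2 * \<delta> / pi)"
    unfolding circle_curve_def using curve_periodic[OF walk_square] by simp
  then have d: "dist (circle_curve \<theta>) (circle_curve \<phi>) = norm (curve square_walk (t + 2 * \<delta> / pi) - curve square_walk t)"
    by (simp add: dist_norm circle_curve_def t_def)
  have u: "\<bar>(t + 2 * \<delta> / pi) - t\<bar> = u" by (simp add: u_def abs_mult)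
  have "u \<le> 2" using \<delta> by (simp add: u_def pos_divide_le_eq)
  then have b: "sqrt u / 45 \<le> dist (circle_curve \<theta>) (circle_curve \<phi>)" "dist (circle_curve \<theta>) (circle_curve \<phi>) \<le> 228 * sqrt u"
    using curve_snowflake[OF walk_square, of "t + 2 * \<delta> / pi" t] unfolding d u by auto
  have du: "\<bar>\<delta>\<bar> = pi * u / 2" by (simp add: u_def)
  have "0 \<le> u" by (simp add: u_def)
  have "sin (\<bar>\<delta>\<bar> / 2) \<le> \<bar>\<delta>\<bar> / 2" by (intro sin_x_le_x) simp
  also have "\<dots> \<le> u" using mult_right_mono[OF less_imp_le[OF pi_less_4] \<open>0 \<le> u\<close>] by (simp add: du)
  finally have lo: "sqrt (sin (\<bar>\<delta>\<bar> / 2)) \<le> sqrt u" by simp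
  have "u / 4 \<le> \<bar>\<delta>\<bar> / 2 / 2" using mult_right_mono[OF less_imp_le[OF pi_gt_zero] \<open>0 \<le> u\<close>]
      mult_right_mono[of 2 pi u] pi_ge_two \<open>0 \<le> u\<close> by (simp add: du)
  also have "\<dots> \<le> sin (\<bar>\<delta>\<bar> / 2)" using \<delta> by (intro half_le_sin) auto
  finally have "sqrt (u / 4) \<le> sqrt (sin (\<bar>\<delta>\<bar> / 2))" by simp
  then have hi: "sqrt u \<le> 2 * sqrt (sin (\<bar>\<delta>\<bar> / 2))" by (simp add: real_sqrt_divide)
  have "0 \<le> sqrt u" using \<open>0 \<le> u\<close> by simp
  then show "sqrt \<bar>sin ((\<theta> - \<phi>) / 2)\<bar> \<le> 456 * dist (circle_curve \<theta>) (circle_curve \<phi>)"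
    "dist (circle_curve \<theta>) (circle_curve \<phi>) \<le> 456 * sqrt \<bar>sin ((\<theta> - \<phi>) / 2)\<bar>"
    unfolding \<sigma> using b lo hi by linarith+
qed

text \<open>The displacement splits into an angular part at the smaller radius and a radial part of
  size at most \<open>9 * \<rho>\<close>. The first coordinate of \<open>join\<close> detects
  \<rho>, so the radial part can be absorbed.\<close>

lemma cone_bounds:
  fixes r r' \<theta> \<theta>' :: real
  assumes "0 \<le> r" "r \<le> r'"
  defines "D \<equiv> dist (join r (r *\<^sub>R circle_curve \<theta>)) (join r' (r' *\<^sub>R circle_curve \<theta>'))"
    and "E \<equiv> \<bar>r - r'\<bar> + 2 * sqrt (r * r' * \<bar>sin ((\<theta> - \<theta>') / 2)\<bar>)"
  shows "E / 10000 \<le> D \<and> D \<le> 10000 * E"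
proof -
  define g g' \<sigma> \<rho> where "g = circle_curve \<theta>" and "g' = circle_curve \<theta>'"
    and "\<sigma> = \<bar>sin ((\<theta> - \<theta>') / 2)\<bar>" and "\<rho> = r' - r"
  have g: "sqrt \<sigma> \<le> 456 * dist g g'" "dist g g' \<le> 456 * sqrt \<sigma>"
    unfolding g_def g'_def \<sigma>_def by (rule circle_curve_bounds)+
  have "norm g' \<le> 9" unfolding g'_def circle_curve_def by (rule square_curve_bounded)
  have \<sigma>: "0 \<le> \<sigma>" "\<sigma> \<le> 1" "sqrt \<sigma> \<le> 1" by (auto simp: \<sigma>_def)
  have "0 \<le> \<rho>" using assms by (simp add: \<rho>_def)
  define q where "q = sqrt (r * r' * \<sigma>)"
  have E: "E = \<rho> + 2 * q" using assms by (simp add: q_def \<rho>_def \<sigma>_def)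
  have q0: "0 \<le> q" using assms \<sigma> by (simp add: q_def)
  \<comment> \<open>The geometric mean of the radii lies between \<open>r\<close> and
    \<open>r'\<close>, so \<open>q\<close> differs from the angular term at radius \<open>r\<close>
    by at most \<rho>.\<close>
  have "r * sqrt \<sigma> = sqrt (r * r * \<sigma>)" using assms by (simp add: real_sqrt_mult)
  also have "\<dots> \<le> q" unfolding q_def using assms \<sigma> by (intro real_sqrt_le_mono mult_right_mono mult_left_mono) auto
  finally have q1: "r * sqrt \<sigma> \<le> q" .
  have "q \<le> sqrt (r' * r' * \<sigma>)" unfolding q_def using assms \<sigma> by (intro real_sqrt_le_mono mult_right_mono) auto
  also have "\<dots> = r * sqrt \<sigma> + \<rho> * sqrt \<sigma>" using assms by (simp add: real_sqrt_mult \<rho>_def algebra_simps)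
  also have "\<dots> \<le> r * sqrt \<sigma> + \<rho>" using \<sigma> \<open>0 \<le> \<rho>\<close> mult_left_mono[OF \<sigma>(3) \<open>0 \<le> \<rho>\<close>] by simp
  finally have q2: "q \<le> r * sqrt \<sigma> + \<rho>" .
  have rg: "r * sqrt \<sigma> \<le> 456 * (r * dist g g')" "r * dist g g' \<le> 456 * (r * sqrt \<sigma>)"
    using mult_left_mono[OF g(1) assms(1)] mult_left_mono[OF g(2) assms(1)] by simp_all
  have rd: "r * dist g g' = norm (r *\<^sub>R g - r *\<^sub>R g')"
    using assms by (simp add: dist_norm flip: scaleR_diff_right)
  have split: "dist (r *\<^sub>R g) (r' *\<^sub>R g') = norm ((r *\<^sub>R g - r *\<^sub>R g') - \<rho> *\<^sub>R g')"
    by (simp add: dist_norm \<rho>_def algebra_simps)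
  have "norm (\<rho> *\<^sub>R g') \<le> 9 * \<rho>" using mult_left_mono[OF \<open>norm g' \<le> 9\<close> \<open>0 \<le> \<rho>\<close>] \<open>0 \<le> \<rho>\<close> by simp
  then have n: "dist (r *\<^sub>R g) (r' *\<^sub>R g') \<le> r * dist g g' + 9 * \<rho>" "r * dist g g' \<le> dist (r *\<^sub>R g) (r' *\<^sub>R g') + 9 * \<rho>"
    using norm_triangle_ineq4[of "r *\<^sub>R g - r *\<^sub>R g'" "\<rho> *\<^sub>R g'"] norm_triangle_ineq2[of "r *\<^sub>R g - r *\<^sub>R g'" "\<rho> *\<^sub>R g'"]
    unfolding rd split by linarith+
  have D: "\<rho> \<le> D" "dist (r *\<^sub>R g) (r' *\<^sub>R g') \<le> D" "D \<le> \<rho> + dist (r *\<^sub>R g) (r' *\<^sub>R g')"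
    using dist_join_bounds[where a = r and b = r' and v = "r *\<^sub>R g" and w = "r' *\<^sub>R g'"] assms(1,2) by (auto simp: D_def \<rho>_def g_def g'_def)
  show ?thesis
  proof
    \<comment> \<open>The estimates combine to the factor
      \<open>1 + 2 * (456 * 10 + 1) = 9123\<close>, rounded up.\<close>
    have "E \<le> 10000 * D" using E q2 rg(1) n(2) D by linarith
    then show "E / 10000 \<le> D" by simp
    show "D \<le> 10000 * E" using E q0 q1 rg(2) n(1) D \<open>0 \<le> \<rho>\<close> by linarith
  qed
qed

text \<open>The law of cosines gives the horizontal part and the determinant is
  \<open>r * r'\<close> times a sine, up to sign. Written in \<sigma>, the fourth powers of \<sigma>
  cancel; the purely angular term is quadratic in \<sigma>, so its fourth root is a square root of
  the chord.\<close>

lemma polar_koranyi_identity: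
  fixes r r' \<theta> \<theta>' :: real
  defines "\<sigma> \<equiv> sin ((\<theta> - \<theta>') / 2)"
  shows "((r * cos \<theta> - r' * cos \<theta>')\<^sup>2 + (r * sin \<theta> - r' * sin \<theta>')\<^sup>2)\<^sup>2
      + 4 * (r * cos \<theta> * (r' * sin \<theta>') - r' * cos \<theta>' * (r * sin \<theta>))\<^sup>2
    = (r - r') ^ 4 + 8 * (r - r')\<^sup>2 * (r * r') * \<sigma>\<^sup>2 + 16 * (r * r')\<^sup>2 * \<sigma>\<^sup>2"
proof -
  have p: "(sin x)\<^sup>2 + (cos x)\<^sup>2 = 1" for x :: real by simp
  have c: "cos (\<theta> - \<theta>') = 1 - 2 * \<sigma>\<^sup>2"
    using cos_double_sin[of "(\<theta> - \<theta>') / 2"] by (simp only: \<sigma>_def nonzero_mult_div_cancel_left times_divide_eq_right zero_neq_numeral[symmetric] simp_thms)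
  have "(sin (\<theta> - \<theta>'))\<^sup>2 = 1 - (cos (\<theta> - \<theta>'))\<^sup>2" by (simp add: sin_squared_eq)
  then have s: "(sin (\<theta> - \<theta>'))\<^sup>2 = 4 * \<sigma>\<^sup>2 - 4 * (\<sigma>\<^sup>2)\<^sup>2" unfolding c by (simp add: power2_eq_square algebra_simps)
  have "(r * cos \<theta> - r' * cos \<theta>')\<^sup>2 + (r * sin \<theta> - r' * sin \<theta>')\<^sup>2 = r\<^sup>2 + r'\<^sup>2 - 2 * (r * r') * cos (\<theta> - \<theta>')"
    unfolding cos_diff using p[of \<theta>] p[of \<theta>'] by algebra
  also have "\<dots> = (r - r')\<^sup>2 + 4 * (r * r') * \<sigma>\<^sup>2" unfolding c by (simp add: power2_eq_square algebra_simps)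
  finally have 1: "(r * cos \<theta> - r' * cos \<theta>')\<^sup>2 + (r * sin \<theta> - r' * sin \<theta>')\<^sup>2 = (r - r')\<^sup>2 + 4 * (r * r') * \<sigma>\<^sup>2" .
  have "r * cos \<theta> * (r' * sin \<theta>') - r' * cos \<theta>' * (r * sin \<theta>) = - (r * r' * sin (\<theta> - \<theta>'))"
    unfolding sin_diff by (simp add: algebra_simps)
  then have 2: "(r * cos \<theta> * (r' * sin \<theta>') - r' * cos \<theta>' * (r * sin \<theta>))\<^sup>2 = (r * r')\<^sup>2 * (4 * \<sigma>\<^sup>2 - 4 * (\<sigma>\<^sup>2)\<^sup>2)"
    by (simp add: power_mult_distrib s)
  show ?thesis unfolding 1 2 by algebra
qed

lemma Lip_transverse_plane:
  fixes P :: "(real^3) set"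
  assumes P: "\<And>x. x \<in> P \<Longrightarrow> x$3 = a * x$1 + b * x$2 + c"
  shows "Lip_const P koranyi (UNIV :: (real^4) set) dist \<le> ereal 20000"
proof -
  \<comment> \<open>The plane is tangent to the horizontal distribution above the point
    \<open>(2 * b, - 2 * a)\<close>. Left translation of that point of the plane to the origin turns
    the plane into \<open>z = 0\<close>.\<close>
  define z where "z x = Complex (x$1 - 2 * b) (x$2 + 2 * a)" for x :: "real^3"
  define r \<theta> where "r x = cmod (z x)" and "\<theta> x = Arg (z x)" for x
  define E where "E x y = \<bar>r x - r y\<bar> + 2 * sqrt (r x * r y * \<bar>sin ((\<theta> x - \<theta> y) / 2)\<bar>)" for x y
  define f where "f x = join (r x) (r x *\<^sub>R circle_curve (\<theta> x))" for x
  have "Lip_const P koranyi (UNIV :: (real^4) set) dist \<le> ereal (2 * 10000)"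
  proof (rule Lip_const_le[where E = E and f = f])
    fix x y assume xy: "x \<in> P" "y \<in> P"
    have r0: "0 \<le> r x" "0 \<le> r y" by (simp_all add: r_def)
    have polar: "w$1 - 2 * b = r w * cos (\<theta> w)" "w$2 + 2 * a = r w * sin (\<theta> w)" for w
      using arg_cong[OF rcis_cmod_Arg[of "z w"], of Re] arg_cong[OF rcis_cmod_Arg[of "z w"], of Im]
      by (simp_all add: z_def r_def \<theta>_def)
    define X Y X' Y' where "X = x$1 - 2 * b" and "Y = x$2 + 2 * a" and "X' = y$1 - 2 * b" and "Y' = y$2 + 2 * a"
    have d: "x$3 - y$3 + (1/2) * (x$1 * y$2 - y$1 * x$2) = (X * Y' - X' * Y) / 2"
      unfolding P[OF xy(1)] P[OF xy(2)] X_def Y_def X'_def Y'_def by (simp add: field_simps)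
    have "16 * (x$3 - y$3 + (1/2) * (x$1 * y$2 - y$1 * x$2))\<^sup>2 = 4 * (X * Y' - X' * Y)\<^sup>2"
      unfolding d by (simp add: power_divide)
    moreover have "x$1 - y$1 = X - X'" "x$2 - y$2 = Y - Y'" by (simp_all add: X_def Y_def X'_def Y'_def)
    ultimately have k: "koranyi x y = root 4 (((X - X')\<^sup>2 + (Y - Y')\<^sup>2)\<^sup>2 + 4 * (X * Y' - X' * Y)\<^sup>2)"
      by (simp add: koranyi_def)
    define \<rho> \<sigma> q where "\<rho> = \<bar>r x - r y\<bar>" and "\<sigma> = \<bar>sin ((\<theta> x - \<theta> y) / 2)\<bar>" and "q = 2 * sqrt (r x * r y * \<sigma>)"
    have \<sigma>: "0 \<le> \<sigma>" "\<sigma> \<le> 1" by (auto simp: \<sigma>_def)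
    have q2: "q\<^sup>2 = 4 * (r x * r y * \<sigma>)" using r0 \<sigma> by (simp add: q_def power_mult_distrib)
    have q4: "q ^ 4 = 16 * (r x * r y)\<^sup>2 * \<sigma>\<^sup>2"
    proof -
      have "q ^ 4 = (q\<^sup>2)\<^sup>2" by (simp flip: power_mult)
      then show ?thesis unfolding q2 by (simp add: power_mult_distrib)
    qed
    \<comment> \<open>By \<open>\<sigma>\<^sup>2 \<le> \<sigma>\<close> the mixed term is at most
      the middle term of \<open>(\<rho>\<^sup>2 + q\<^sup>2)\<^sup>2\<close>, so the whole sum lies
      between \<open>\<rho> ^ 4 + q ^ 4\<close> and \<open>(\<rho> + q) ^ 4\<close>.\<close>
    define M where "M = 8 * \<rho>\<^sup>2 * (r x * r y) * \<sigma>\<^sup>2"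
    have "koranyi x y = root 4 ((r x - r y) ^ 4 + 8 * (r x - r y)\<^sup>2 * (r x * r y) * \<sigma>\<^sup>2 + 16 * (r x * r y)\<^sup>2 * \<sigma>\<^sup>2)"
      unfolding k X_def Y_def X'_def Y'_def polar polar_koranyi_identity by (simp add: \<sigma>_def)
    then have k2: "koranyi x y = root 4 (\<rho> ^ 4 + M + q ^ 4)" by (simp add: M_def \<rho>_def q4)
    have M0: "0 \<le> M" using r0 by (simp add: M_def)
    have "\<sigma>\<^sup>2 \<le> \<sigma>" using \<sigma> by (simp add: power2_eq_square mult_left_le)
    then have "8 * \<rho>\<^sup>2 * (r x * r y) * \<sigma>\<^sup>2 \<le> 8 * \<rho>\<^sup>2 * (r x * r y) * \<sigma>" using r0 by (intro mult_left_mono) auto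
    then have M1: "M \<le> 2 * \<rho>\<^sup>2 * q\<^sup>2" unfolding M_def q2 by (simp add: ac_simps)
    have pq: "0 \<le> \<rho>" "0 \<le> q" using r0 \<sigma> by (auto simp: \<rho>_def q_def)
    have "\<rho>\<^sup>2 + q\<^sup>2 \<le> (\<rho> + q)\<^sup>2" using pq by (simp add: power2_sum)
    then have "(\<rho>\<^sup>2 + q\<^sup>2)\<^sup>2 \<le> ((\<rho> + q)\<^sup>2)\<^sup>2" by (intro power_mono) auto
    moreover have "(\<rho>\<^sup>2 + q\<^sup>2)\<^sup>2 = \<rho> ^ 4 + 2 * \<rho>\<^sup>2 * q\<^sup>2 + q ^ 4" by (simp add: power2_sum)
    ultimately have "\<rho> ^ 4 + M + q ^ 4 \<le> (\<rho> + q) ^ 4" using M1 by simp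
    then show "E x y / 2 \<le> koranyi x y \<and> koranyi x y \<le> E x y"
      using root4_sum_bounds[of \<rho> q "\<rho> ^ 4 + M + q ^ 4"] pq M0 by (simp add: k2 E_def \<rho>_def q_def \<sigma>_def)
    show "E x y / 10000 \<le> dist (f x) (f y) \<and> dist (f x) (f y) \<le> 10000 * E x y"
    proof (cases "r x \<le> r y")
      case True
      then show ?thesis using cone_bounds[OF r0(1), of "r y" "\<theta> x" "\<theta> y"] by (simp add: E_def f_def)
    next
      case False
      have "sin ((\<theta> y - \<theta> x) / 2) = - sin ((\<theta> x - \<theta> y) / 2)"
        using sin_minus[of "(\<theta> x - \<theta> y) / 2"] by (simp add: minus_divide_left)
      then have sym: "E x y = E y x" by (simp add: E_def abs_minus_commute mult.commute)
      show ?thesis unfolding sym dist_commute[of "f x"] unfolding E_def f_def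
        using False by (intro cone_bounds r0) simp
    qed
  qed simp
  then show ?thesis by simp
qed

lemma Lip_plane:
  fixes P :: "(real^3) set"
  assumes "affine P" "aff_dim P = 2"
  shows "Lip_const P koranyi (UNIV :: (real^4) set) dist \<le> ereal 20000"
proof -
  have hull: "affine hull P = P" using assms(1) by (simp add: affine_hull_eq)
  have "aff_dim P = DIM(real^3) - 1" using assms(2) by simp
  then obtain n :: "real^3" and c where n: "n \<noteq> 0" and P: "P = {x. n \<bullet> x = c}"
    unfolding aff_dim_eq_hyperplane hull by blast
  have inner: "n \<bullet> x = n$1 * x$1 + n$2 * x$2 + n$3 * x$3" for x by (simp add: inner_vec_def sum_3)
  show ?thesis
  proof (cases "n$3 = 0")
    case True
    define N where "N = sqrt ((n$1)\<^sup>2 + (n$2)\<^sup>2)"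
    have "n$1 \<noteq> 0 \<or> n$2 \<noteq> 0" using n True by (auto simp: vec_eq_iff forall_3)
    then have "0 < (n$1)\<^sup>2 + (n$2)\<^sup>2" by (simp add: sum_power2_gt_zero_iff)
    then have N: "0 < N" "N\<^sup>2 = (n$1)\<^sup>2 + (n$2)\<^sup>2" by (simp_all add: N_def)
    have "(n$1 / N)\<^sup>2 + (n$2 / N)\<^sup>2 = 1"
      unfolding power_divide add_divide_distrib[symmetric] N(2)[symmetric] using N(1) by simp
    moreover have "n$1 / N * x$1 + n$2 / N * x$2 = c / N" if "x \<in> P" for x
      using that N(1) True by (simp add: P inner flip: add_divide_distrib)
    ultimately have "Lip_const P koranyi (UNIV :: (real^4) set) dist \<le> ereal 456"
      by (rule Lip_vertical_plane)
    then show ?thesis by (rule order_trans) simp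
  next
    case False
    have "x$3 = (- n$1 / n$3) * x$1 + (- n$2 / n$3) * x$2 + c / n$3" if "x \<in> P" for x
      using that False by (simp add: P inner field_simps)
    then show ?thesis by (rule Lip_transverse_plane)
  qed
qed

theorem theorem1p1:
  shows "\<exists>L::real. L > 1 \<and>
    (\<forall>l :: (real^3) set. affine l \<and> aff_dim l = 1 \<longrightarrow>
        Lip_const l koranyi (UNIV :: (real^3) set) dist \<le> ereal L) \<and>
    (\<forall>P :: (real^3) set. affine P \<and> aff_dim P = 2 \<longrightarrow>
        Lip_const P koranyi (UNIV :: (real^4) set) dist \<le> ereal L)"
proof (intro exI[of _ 20000] conjI allI impI)
  fix l :: "(real^3) set" assume "affine l \<and> aff_dim l = 1"
  then have "Lip_const l koranyi (UNIV :: (real^3) set) dist \<le> ereal 456" by (intro Lip_line) auto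
  then show "Lip_const l koranyi (UNIV :: (real^3) set) dist \<le> ereal 20000" by (rule order_trans) simp
qed (auto intro: Lip_plane)

end
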